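(* Let $G\le\mathrm{Sym}(\Omega)$ be a finite transitive permutation group. Suppose that $G\cong\mathsf{A}_n$ for some $n\ge5$. Then every element of $G$ is a product of two derangements.
   Context: $\mathsf{A}_n$ is the alternating group of degree $n$; the action on $\Omega$ is an arbitrary faithful transitive action, not necessarily the natural one. A derangement in $G$ is an element of $G$ fixing no point of $\Omega$. *)

theory Defs
  imports "HOL-Algebra.Bij" "HOL-Algebra.Group_Action" "HOL-Algebra.Sym_Groups"
begin

text \<open>A permutation group on \<open>\<Omega>\<close> is given by its set of elements \<open>G\<close>, a subgroup of
  \<^term>\<open>BijGroup \<Omega>\<close>; the group itself is the following structure.\<close>

abbreviation perm_group :: "'a set \<Rightarrow> ('a \<Rightarrow> 'a) set \<Rightarrow> ('a \<Rightarrow> 'a) monoid"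
  where "perm_group \<Omega> G \<equiv> (BijGroup \<Omega>)\<lparr>carrier := G\<rparr>"

text \<open>The natural action of a permutation group is the inclusion into \<^term>\<open>BijGroup \<Omega>\<close>.\<close>

definition transitive_perm_group :: "'a set \<Rightarrow> ('a \<Rightarrow> 'a) set \<Rightarrow> bool"
  where "transitive_perm_group \<Omega> G \<longleftrightarrow>
    subgroup G (BijGroup \<Omega>) \<and> transitive_action (perm_group \<Omega> G) \<Omega> (\<lambda>g. g)"

definition derangements :: "'a set \<Rightarrow> ('a \<Rightarrow> 'a) set \<Rightarrow> ('a \<Rightarrow> 'a) set"
  where "derangements \<Omega> G = {g \<in> G. \<forall>x\<in>\<Omega>. g x \<noteq> x}"

end

theory Submission
  imports Defs "HOL-Computational_Algebra.Primes"
begin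

text \<open>Let \<open>H\<close> be a point stabiliser, seen as a proper subgroup of \<open>Alt(V)\<close> with \<open>V = {1..n}\<close>. It
  suffices to find a property of permutations that is invariant under conjugation, fails on \<open>H\<close>, and
  is such that every even permutation is a product of two even permutations having it. Depending on \<open>H\<close>,
  one of the following works. For odd \<open>n\<close>: being an \<open>n\<close>-cycle, if \<open>H\<close> contains none, so that otherwise
  \<open>H\<close> is transitive; being an \<open>(n - 2)\<close>-cycle, if \<open>H\<close> contains none. For even \<open>n\<close>: being an
  \<open>(n - 1)\<close>-cycle, if \<open>H\<close> contains none; being fixed point free, if \<open>H\<close> fixes a point. In the remaining
  cases \<open>H\<close> is primitive on \<open>V\<close>, hence contains no 3-cycle, and one takes the permutations whose fourth
  power is a 3-cycle. These suffice except for the permutations of cycle type \<open>(4,2)\<close> in degree 6;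
  that class is added, and it avoids \<open>H\<close> as well.\<close>

text \<open>No single class serves every \<open>H\<close>: it must miss \<open>H\<close>, and yet
  its products must reach every even permutation. The cycle lengths n, n - 1 and n - 2 are chosen by
  parity, so that the cycles are even. If \<open>H\<close> contains such cycles, they restrict its
  blocks until only primitivity or a common fixed point is left. Properness of \<open>H\<close> then
  enters through Jordan's theorem: a primitive group with one 3-cycle contains all of them. The
  exponent 4 has two sources. A 3-cycle is its own fourth power, while a disjoint factor of order
  dividing 4 disappears; so once a small part of \<open>g\<close> is factored by means of 3-cycles,
  the rest need only be a product of two elements of order dividing 4. Every permutation is a
  product of two involutions, but these may be odd. A transposition mends the sign, and may fuse two
  2-cycles into a 4-cycle, which the exponent 2 would not tolerate.\<close>

text \<open>Over an arbitrary set, because the constructions pass to subsets. As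
  \<open>permutes\<close> demands the identity outside, \<open>alt W\<close> is literally contained
  in \<open>alt V\<close> for \<open>W\<close> inside \<open>V\<close>.\<close>

definition alt :: "'a set \<Rightarrow> ('a \<Rightarrow> 'a) set"
  where "alt V = {p. p permutes V \<and> sign p = 1}"

lemma permutation_if_permutes: "p permutes V \<Longrightarrow> finite V \<Longrightarrow> permutation p"
  by (auto simp: permutation_permutes)

lemma permutes_Diff:
  assumes "p permutes V" "\<And>w. w \<in> W \<Longrightarrow> p w = w"
  shows "p permutes (V - W)"
  using assms by (intro permutes_superset[OF assms(1)]) auto

lemma alt_compose:
  assumes "finite V" "p \<in> alt V" "q \<in> alt V"
  shows "p \<circ> q \<in> alt V"
  using assms unfolding alt_def
  by (auto simp: permutes_compose sign_compose permutation_if_permutes)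

lemma alt_mono: "V \<subseteq> W \<Longrightarrow> alt V \<subseteq> alt W"
  by (auto simp: alt_def intro: permutes_subset)

lemma disjoint_permutes_commute:
  assumes "p permutes A" "q permutes B" "A \<inter> B = {}"
  shows "p \<circ> q = q \<circ> p"
proof
  fix v
  show "(p \<circ> q) v = (q \<circ> p) v"
  proof (cases "v \<in> A")
    case True
    then have "v \<notin> B" "p v \<notin> B"
      using assms permutes_in_image[OF assms(1)] by auto
    then show ?thesis using assms by (simp add: permutes_not_in)
  next
    case False
    then have "q v \<notin> A"
      using assms permutes_in_image[OF assms(2)] by (cases "v \<in> B") (auto simp: permutes_not_in)
    then show ?thesis using assms False by (simp add: permutes_not_in)
  qed
qed

section \<open>Products of two long cycles\<close>

text \<open>The sign clause is redundant; having it here lets the inductive construction of cycles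
  keep track of the sign.\<close>

definition full_cycle_on :: "'a set \<Rightarrow> ('a \<Rightarrow> 'a) \<Rightarrow> bool"
  where "full_cycle_on S x \<longleftrightarrow> x permutes S \<and> (\<forall>a\<in>S. \<forall>b\<in>S. \<exists>k. (x ^^ k) a = b)
    \<and> sign x = (- 1) ^ (card S + 1)"

lemma funpow_reach_trans:
  assumes "(x ^^ k) a = b" "(x ^^ l) b = c"
  shows "(x ^^ (l + k)) a = c"
  using assms by (simp add: funpow_add)

text \<open>If \<open>x w = u\<close>, the new map sends \<open>w\<close> to \<open>b\<close> and
  \<open>b\<close> to \<open>u\<close>: the point \<open>b\<close> is inserted on the arc into
  \<open>u\<close>, and all other arcs stay. A step of \<open>x\<close> becomes one or two
  steps.\<close>

lemma full_cycle_on_insert: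
  assumes "full_cycle_on S x" "finite S" "b \<notin> S" "u \<in> S"
  shows "full_cycle_on (insert b S) (transpose b u \<circ> x)"
proof -
  let ?y = "transpose b u \<circ> x"
  from assms have x: "x permutes S" and sx: "sign x = (- 1) ^ (card S + 1)"
    and reach: "\<And>a c. a \<in> S \<Longrightarrow> c \<in> S \<Longrightarrow> \<exists>k. (x ^^ k) a = c"
    by (auto simp: full_cycle_on_def)
  have bu: "b \<noteq> u" using assms by auto
  have xb: "x b = b" using x assms by (simp add: permutes_not_in)
  have y: "?y permutes insert b S"
    using assms x by (intro permutes_compose permutes_swap_id) (auto intro: permutes_subset)
  have "permutation x" using x assms permutation_if_permutes by blast
  then have sy: "sign ?y = (- 1) ^ (card (insert b S) + 1)"
    using assms bu sx by (simp add: sign_compose permutation_swap_id sign_swap_id)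
  have step: "\<exists>k. (?y ^^ k) a = x a" if "a \<in> S" for a
  proof (cases "x a = u")
    case True
    then have "(?y ^^ 2) a = x a" using xb bu by (simp add: numeral_2_eq_2)
    then show ?thesis by blast
  next
    case False
    have "x a \<noteq> b" using that assms x by (metis permutes_in_image)
    then have "(?y ^^ 1) a = x a" using False by simp
    then show ?thesis by blast
  qed
  have pow: "\<exists>k. (?y ^^ k) a = (x ^^ m) a" if "a \<in> S" for a m
  proof (induction m)
    case 0
    have "(?y ^^ 0) a = (x ^^ 0) a" by simp
    then show ?case by blast
  next
    case (Suc m)
    have "(x ^^ m) a \<in> S" using that x by (simp add: permutes_in_funpow_image)
    from step[OF this] obtain l where "(?y ^^ l) ((x ^^ m) a) = (x ^^ Suc m) a" by auto
    with Suc show ?case using funpow_reach_trans[of _ ?y] by blast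
  qed
  have inS: "\<exists>k. (?y ^^ k) a = c" if "a \<in> S" "c \<in> S" for a c
    using reach[OF that] pow[OF that(1)] by metis
  have toS: "\<exists>k. (?y ^^ k) b = c" if "c \<in> S" for c
  proof -
    have "(?y ^^ 1) b = u" using xb by simp
    with inS[OF assms(4) that] show ?thesis using funpow_reach_trans by metis
  qed
  have fromS: "\<exists>k. (?y ^^ k) a = b" if "a \<in> S" for a
  proof -
    obtain w where w: "w \<in> S" "x w = u" using x assms(4) by (metis permutes_inv permutes_in_image permutes_inverses(1))
    have "(?y ^^ 1) w = b" using w by simp
    with inS[OF that w(1)] show ?thesis using funpow_reach_trans by metis
  qed
  have bb: "(?y ^^ 0) b = b" by simp
  have "\<exists>k. (?y ^^ k) a = c" if "a \<in> insert b S" "c \<in> insert b S" for a c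
    using that inS toS fromS bb by (metis insert_iff)
  with y sy show ?thesis unfolding full_cycle_on_def by blast
qed

text \<open>As \<open>x\<close> fixes \<open>b\<close>, the transposition \<open>(b u)\<close> on
  the right equals \<open>(b (x u))\<close> on the left; now \<open>b\<close> is inserted on the arc
  leaving \<open>u\<close>.\<close>

lemma full_cycle_on_insert':
  assumes "full_cycle_on S x" "finite S" "b \<notin> S" "u \<in> S"
  shows "full_cycle_on (insert b S) (x \<circ> transpose b u)"
proof -
  have x: "x permutes S" using assms by (simp add: full_cycle_on_def)
  have "x \<circ> transpose b u = transpose b (x u) \<circ> x"
  proof
    fix v
    have "x b = b" using x assms by (simp add: permutes_not_in)
    then show "(x \<circ> transpose b u) v = (transpose b (x u) \<circ> x) v"
      using permutes_inj[OF x] by (auto simp: transpose_def inj_eq)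
  qed
  moreover have "x u \<in> S" using x assms by (simp add: permutes_in_image)
  ultimately show ?thesis using full_cycle_on_insert assms by metis
qed

lemma full_cycle_on_conjugate:
  assumes "full_cycle_on S x" "finite V" "S \<subseteq> V" "p permutes V"
  shows "full_cycle_on (p ` S) (p \<circ> x \<circ> inv' p)"
proof -
  have x: "x permutes S" using assms by (simp add: full_cycle_on_def)
  have inj: "inj p" using assms permutes_inj by blast
  have ip: "inv' p (p v) = v" for v using assms(4) permutes_inverses(2) by metis
  have pow: "((p \<circ> x \<circ> inv' p) ^^ k) (p a) = p ((x ^^ k) a)" for k a
    by (induction k) (auto simp: ip)
  have perms: "permutation p" "permutation x" "permutation (inv' p)"
    using assms x permutation_if_permutes finite_subset permutes_inv by blast+
  have "p \<circ> x \<circ> inv' p permutes p ` S"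
  proof (rule bij_imp_permutes)
    have b: "bij_betw p S (p ` S)" using inj by (auto simp: bij_betw_def intro: inj_on_subset)
    have b': "bij_betw (inv' p) (p ` S) S"
      using inj by (auto simp: bij_betw_def inj_on_def ip image_iff)
    show "bij_betw (p \<circ> x \<circ> inv' p) (p ` S) (p ` S)"
      using bij_betw_trans[OF bij_betw_trans[OF b' permutes_imp_bij[OF x]] b] by (simp add: comp_assoc)
    fix v assume "v \<notin> p ` S"
    then have "inv' p v \<notin> S" using permutes_inverses(1)[OF assms(4)] by (metis imageI)
    then show "(p \<circ> x \<circ> inv' p) v = v"
      using x permutes_inverses(1)[OF assms(4)] by (simp add: permutes_not_in)
  qed
  moreover have "sign (p \<circ> x \<circ> inv' p) = sign x"
    using perms by (simp add: sign_compose permutation_compose sign_inverse)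
  moreover have "card (p ` S) = card S" using inj by (metis card_image inj_on_subset subset_UNIV)
  ultimately show ?thesis
    using assms(1) pow unfolding full_cycle_on_def by fastforce
qed

lemma full_cycle_on_neq:
  assumes "full_cycle_on S x" "a \<in> S" "card S \<ge> 2"
  shows "x a \<noteq> a"
proof
  assume "x a = a"
  then have "(x ^^ k) a = a" for k by (induction k) auto
  with assms(1,2) have "S \<subseteq> {a}" unfolding full_cycle_on_def by (metis singletonI subsetI)
  then show False using assms(3) card_mono[of "{a}" S] by auto
qed

text \<open>Serves to choose auxiliary points. The bound on \<open>card B\<close> usually comes from
  \<open>card_length\<close>, so that it does not matter whether the excluded points
  coincide.\<close>

lemma exists_not_in:
  assumes "finite B" "card B < card V"
  obtains v where "v \<in> V" "v \<notin> B"
proof -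
  have "\<not> V \<subseteq> B" using assms card_mono[of B V] by auto
  then show ?thesis using that by blast
qed

text \<open>The transpositions \<open>(b, g d)\<close> and \<open>(b, d)\<close> strip the point \<open>b\<close> from \<open>g\<close>; multiplied back, they
  insert \<open>b\<close> into both cycles obtained for the smaller set.\<close>

theorem even_eq_full_cycles:
  assumes "finite S" "S \<noteq> {}" "g \<in> alt S"
  shows "\<exists>x y. full_cycle_on S x \<and> full_cycle_on S y \<and> g = x \<circ> y"
  using assms
proof (induction "card S" arbitrary: S g rule: less_induct)
  case less
  from less.prems have g: "g permutes S" and sg: "sign g = 1" by (auto simp: alt_def)
  obtain b where b: "b \<in> S" using less.prems by blast
  consider "card S = 1" | "card S = 2" | "card S \<ge> 3"
    using less.prems by (metis One_nat_def Suc_leI card_gt_0_iff le_neq_implies_less numeral_2_eq_2 numeral_3_eq_3)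
  then show ?case
  proof cases
    case 1
    then have "S = {b}" using b by (metis card_1_singletonE singletonD)
    then have "g = id" "full_cycle_on S id" using g by (auto simp: full_cycle_on_def intro: exI[of _ 0])
    then show ?thesis by (intro exI[of _ id]) auto
  next
    case 2
    then obtain u v where uv: "S = {u, v}" "u \<noteq> v" by (auto simp: card_2_iff)
    have "g = id" using g sg uv by (auto simp: permutes_doubleton_iff sign_swap_id)
    moreover have "full_cycle_on {v} id" by (auto simp: full_cycle_on_def intro: exI[of _ 0])
    from full_cycle_on_insert[OF this, of u v] uv have "full_cycle_on S (transpose u v)" by auto
    ultimately show ?thesis
      by (intro exI[of _ "transpose u v"]) auto
  next
    case 3
    \<comment> \<open>Excluding \<open>b\<close> and \<open>inv' g b\<close> makes both
      transpositions in \<open>h\<close> genuine, so their signs cancel. The path of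
      \<open>b\<close> under \<open>h\<close> is \<open>b\<close>, \<open>d\<close>,
      \<open>g d\<close>, \<open>b\<close>.\<close>
    obtain d where d: "d \<in> S" "d \<notin> {b, inv' g b}"
      by (rule exists_not_in[of "{b, inv' g b}" S]) (use 3 card_length[of "[b, inv' g b]"] in auto)
    have gd: "g d \<in> S" "g d \<noteq> b" using d g by (auto simp: permutes_in_image permutes_inverses)
    define h where "h = transpose b (g d) \<circ> g \<circ> transpose b d"
    have hS: "h permutes S" unfolding h_def
      using g b d gd by (intro permutes_compose permutes_swap_id) auto
    have "h b = b" by (simp add: h_def)
    with hS have hp: "h permutes (S - {b})" by (intro permutes_Diff) auto
    have "permutation g" using g less.prems permutation_if_permutes by blast
    then have "sign h = 1" unfolding h_def
      using sg d gd by (auto simp: sign_compose permutation_compose permutation_swap_id sign_swap_id)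
    then have "h \<in> alt (S - {b})" using hp by (simp add: alt_def)
    moreover have "card (S - {b}) < card S" "S - {b} \<noteq> {}"
      using b d less.prems by (auto intro!: card_Diff1_less simp del: card_Diff_insert)
    ultimately obtain x y where xy: "full_cycle_on (S - {b}) x" "full_cycle_on (S - {b}) y" "h = x \<circ> y"
      using less.hyps[of "S - {b}" h] less.prems by auto
    have "full_cycle_on (insert b (S - {b})) (transpose b (g d) \<circ> x)"
      by (rule full_cycle_on_insert) (use xy less.prems gd in auto)
    moreover have "full_cycle_on (insert b (S - {b})) (y \<circ> transpose b d)"
      by (rule full_cycle_on_insert') (use xy less.prems d in auto)
    moreover have "g = (transpose b (g d) \<circ> x) \<circ> (y \<circ> transpose b d)"
    proof -
      have "(transpose b (g d) \<circ> x) \<circ> (y \<circ> transpose b d) = transpose b (g d) \<circ> h \<circ> transpose b d"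
        by (simp add: xy comp_assoc)
      also have "\<dots> = g" by (simp add: h_def fun_eq_iff)
      finally show ?thesis by simp
    qed
    ultimately show ?thesis using b by (metis insert_Diff)
  qed
qed

text \<open>If \<open>g\<close> has no fixed point, the two cycles have to miss different points,
  since a point missed by both is fixed by \<open>g\<close>. So \<open>a\<close> and
  \<open>b\<close> are both stripped from \<open>g\<close>, but \<open>b\<close> is returned to
  \<open>x\<close> only and \<open>a\<close> to \<open>y\<close> only.\<close>

lemma even_eq_near_full_cycles:
  assumes "finite V" "card V \<ge> 3" "g \<in> alt V"
  shows "\<exists>a\<in>V. \<exists>b\<in>V. \<exists>x y. full_cycle_on (V - {a}) x \<and> full_cycle_on (V - {b}) y \<and> g = x \<circ> y"
proof (cases "\<exists>a\<in>V. g a = a")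
  case True
  then obtain a where a: "a \<in> V" "g a = a" by blast
  have "g \<in> alt (V - {a})" using assms a by (auto simp: alt_def intro: permutes_Diff)
  moreover have "V - {a} \<noteq> {}"
    using assms by (metis card.empty card_Diff_singleton a(1) diff_is_0_eq not_numeral_le_zero numeral_le_one_iff order_trans semiring_norm(70))
  ultimately obtain x y where "full_cycle_on (V - {a}) x" "full_cycle_on (V - {a}) y" "g = x \<circ> y"
    using even_eq_full_cycles[of "V - {a}" g] assms(1) by auto
  then show ?thesis using a by blast
next
  case False
  from assms have g: "g permutes V" and sg: "sign g = 1" by (auto simp: alt_def)
  obtain a where a: "a \<in> V" using assms by fastforce
  define d where "d = inv' g a"
  have d: "d \<in> V" "g d = a" unfolding d_def
    using a g by (auto simp: permutes_inverses intro: permutes_in_image[OF permutes_inv[OF g], THEN iffD2])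
  have da: "d \<noteq> a" using False a d by auto
  obtain b where b: "b \<in> V" "b \<notin> {a, d}"
    by (rule exists_not_in[of "{a, d}" V]) (use assms card_length[of "[a, d]"] in auto)
  have gb: "g b \<in> V" "g b \<noteq> b" "g b \<noteq> a"
    using b g False d by (auto simp: permutes_in_image) (metis b(2) d(2) g insertI1 insert_commute permutes_inverses(2))
  define h where "h = transpose b (g b) \<circ> g \<circ> transpose a d"
  have hV: "h permutes V" unfolding h_def
    using g b d a gb by (intro permutes_compose permutes_swap_id) auto
  have "h b = b" "h a = a" using b gb d by (auto simp: h_def)
  with hV have hp: "h permutes (V - {a, b})" by (intro permutes_Diff) auto
  have "permutation g" using g assms permutation_if_permutes by blast
  then have "sign h = 1" unfolding h_def
    using sg da gb by (auto simp: sign_compose permutation_compose permutation_swap_id sign_swap_id)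
  then have "h \<in> alt (V - {a, b})" using hp by (simp add: alt_def)
  moreover have "d \<in> V - {a, b}" using d da b by auto
  ultimately obtain x y where xy: "full_cycle_on (V - {a, b}) x" "full_cycle_on (V - {a, b}) y" "h = x \<circ> y"
    using even_eq_full_cycles[of "V - {a, b}" h] assms(1) by auto
  have "full_cycle_on (insert b (V - {a, b})) (transpose b (g b) \<circ> x)"
    by (rule full_cycle_on_insert) (use xy assms gb in auto)
  moreover have "insert b (V - {a, b}) = V - {a}" using b by auto
  moreover have "full_cycle_on (insert a (V - {a, b})) (y \<circ> transpose a d)"
    by (rule full_cycle_on_insert') (use xy assms d da b in auto)
  moreover have "insert a (V - {a, b}) = V - {b}" using b a by auto
  moreover have "g = (transpose b (g b) \<circ> x) \<circ> (y \<circ> transpose a d)"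
  proof -
    have "(transpose b (g b) \<circ> x) \<circ> (y \<circ> transpose a d) = transpose b (g b) \<circ> h \<circ> transpose a d"
      by (simp add: xy comp_assoc)
    also have "\<dots> = g" by (simp add: h_def fun_eq_iff)
    finally show ?thesis by simp
  qed
  ultimately show ?thesis using a b by metis
qed

text \<open>The preceding construction with two points on each side: \<open>b1\<close>,
  \<open>b2\<close> are returned to \<open>x\<close> only, and \<open>a1\<close>, \<open>a2\<close>
  to \<open>y\<close> only.\<close>

lemma even_eq_cycles_two_fixed:
  assumes "finite V" "card V \<ge> 8" "g \<in> alt V"
  shows "\<exists>a1\<in>V. \<exists>a2\<in>V. \<exists>b1\<in>V. \<exists>b2\<in>V. \<exists>x y. a1 \<noteq> a2 \<and> b1 \<noteq> b2 \<and>
    full_cycle_on (V - {a1, a2}) x \<and> full_cycle_on (V - {b1, b2}) y \<and> g = x \<circ> y"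
proof (cases "\<exists>a\<in>V. g a = a")
  case True
  then obtain a where a: "a \<in> V" "g a = a" by blast
  have "g \<in> alt (V - {a})" using assms a by (auto simp: alt_def intro: permutes_Diff)
  moreover have "card (V - {a}) \<ge> 3" using assms a by simp
  ultimately obtain a2 b2 x y where *: "a2 \<in> V - {a}" "b2 \<in> V - {a}"
    "full_cycle_on (V - {a} - {a2}) x" "full_cycle_on (V - {a} - {b2}) y" "g = x \<circ> y"
    using even_eq_near_full_cycles[of "V - {a}" g] assms(1) by blast
  moreover have "V - {a} - {a2} = V - {a, a2}" "V - {a} - {b2} = V - {a, b2}" by auto
  ultimately have "full_cycle_on (V - {a, a2}) x \<and> full_cycle_on (V - {a, b2}) y \<and> g = x \<circ> y" "a \<noteq> a2" "a \<noteq> b2" by auto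
  then show ?thesis using a *(1,2) by blast
next
  case False
  from assms have g: "g permutes V" and sg: "sign g = 1" by (auto simp: alt_def)
  have gi: "g u = g v \<longleftrightarrow> u = v" for u v using permutes_inj[OF g] by (simp add: inj_eq)
  have V: "g u \<in> V" "inv' g u \<in> V" if "u \<in> V" for u
    using that g permutes_inv[OF g] by (simp_all add: permutes_in_image)
  have nf: "g u \<noteq> u" if "u \<in> V" for u using False that by blast
  obtain b1 where b1: "b1 \<in> V" using assms by fastforce
  obtain b2 where b2: "b2 \<in> V" "b2 \<notin> {b1, g b1, inv' g b1}"
    by (rule exists_not_in[of "{b1, g b1, inv' g b1}" V]) (use assms card_length[of "[b1, g b1, inv' g b1]"] in auto)
  obtain a1 where a1: "a1 \<in> V" "a1 \<notin> {b1, b2, g b1, g b2}"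
    by (rule exists_not_in[of "{b1, b2, g b1, g b2}" V]) (use assms card_length[of "[b1, b2, g b1, g b2]"] in auto)
  \<comment> \<open>The exclusions keep \<open>g b1\<close>, \<open>g b2\<close> and the preimages
    of \<open>a1\<close>, \<open>a2\<close> away from \<open>{a1, a2, b1, b2}\<close>, so that the
    four transpositions do not interfere. Seven excluded points account for the bound 8.\<close>
  obtain a2 where a2: "a2 \<in> V" "a2 \<notin> {b1, b2, g b1, g b2, a1, g a1, inv' g a1}"
    by (rule exists_not_in[of "{b1, b2, g b1, g b2, a1, g a1, inv' g a1}" V])
      (use assms card_length[of "[b1, b2, g b1, g b2, a1, g a1, inv' g a1]"] in auto)
  define d1 d2 where "d1 = inv' g a1" and "d2 = inv' g a2"
  have gd: "g d1 = a1" "g d2 = a2" unfolding d1_def d2_def using permutes_inverses(1)[OF g] by auto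
  define U where "U = V - {a1, a2, b1, b2}"
  have dist: "b1 \<noteq> b2" "a1 \<noteq> a2" "a1 \<noteq> b1" "a1 \<noteq> b2" "a2 \<noteq> b1" "a2 \<noteq> b2" "d1 \<noteq> d2"
    using b2 a1 a2 gd by auto
  have gbU: "g b1 \<in> U" "g b2 \<in> U"
    unfolding U_def using V b1 b2 a1 a2 nf permutes_inverses(2)[OF g] by auto
  have dU: "d1 \<in> U" "d2 \<in> U"
    unfolding U_def using V[OF a1(1)] V[OF a2(1)] a1 a2 nf[of a1] nf[of a2] gd
    by (auto simp flip: d1_def d2_def)
  define h where "h = transpose b2 (g b2) \<circ> transpose b1 (g b1) \<circ> g \<circ> transpose a2 d2 \<circ> transpose a1 d1"
  have hV: "h permutes V" unfolding h_def
    using g b1 b2 a1 a2 gbU dU by (intro permutes_compose permutes_swap_id) (auto simp: U_def)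
  have ne: "d1 \<noteq> a1" "d1 \<noteq> a2" "d1 \<noteq> b1" "d1 \<noteq> b2" "d2 \<noteq> a1" "d2 \<noteq> a2" "d2 \<noteq> b1" "d2 \<noteq> b2"
    "g b1 \<noteq> a1" "g b1 \<noteq> a2" "g b1 \<noteq> b1" "g b1 \<noteq> b2" "g b2 \<noteq> a1" "g b2 \<noteq> a2" "g b2 \<noteq> b1" "g b2 \<noteq> b2" "g b1 \<noteq> g b2"
    using dU gbU dist by (auto simp: U_def gi)
  have "h a1 = a1" "h a2 = a2" "h b1 = b1" "h b2 = b2"
    unfolding h_def o_apply by (simp_all add: transpose_def gd ne dist dist[symmetric] ne[symmetric])
  with hV have hp: "h permutes U" unfolding U_def by (intro permutes_Diff) auto
  have "permutation g" using g assms permutation_if_permutes by blast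
  then have "sign h = 1" unfolding h_def
    using sg ne dist by (auto simp: sign_compose permutation_compose permutation_swap_id sign_swap_id)
  then have "h \<in> alt U" using hp by (simp add: alt_def)
  moreover have fU: "finite U" using assms by (simp add: U_def)
  ultimately obtain x y where xy: "full_cycle_on U x" "full_cycle_on U y" "h = x \<circ> y"
    using even_eq_full_cycles[of U h] dU(1) by auto
  have "full_cycle_on (insert b1 (insert b2 U)) (transpose b1 (g b1) \<circ> (transpose b2 (g b2) \<circ> x))"
    using xy fU gbU dist by (intro full_cycle_on_insert) (auto simp: U_def)
  moreover have "insert b1 (insert b2 U) = V - {a1, a2}" using b1 b2 dist by (auto simp: U_def)
  moreover have "full_cycle_on (insert a2 (insert a1 U)) (y \<circ> transpose a1 d1 \<circ> transpose a2 d2)"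
    using xy fU dU dist by (intro full_cycle_on_insert') (auto simp: U_def)
  moreover have "insert a2 (insert a1 U) = V - {b1, b2}" using a1 a2 dist by (auto simp: U_def)
  moreover have "g = (transpose b1 (g b1) \<circ> (transpose b2 (g b2) \<circ> x)) \<circ> (y \<circ> transpose a1 d1 \<circ> transpose a2 d2)"
  proof -
    have "(transpose b1 (g b1) \<circ> (transpose b2 (g b2) \<circ> x)) \<circ> (y \<circ> transpose a1 d1 \<circ> transpose a2 d2)
       = transpose b1 (g b1) \<circ> transpose b2 (g b2) \<circ> h \<circ> transpose a1 d1 \<circ> transpose a2 d2"
      by (simp add: xy comp_assoc)
    also have "\<dots> = g" by (simp add: h_def fun_eq_iff)
    finally show ?thesis by simp
  qed
  ultimately show ?thesis using a1(1) a2(1) b1 b2(1) dist(1,2) by metis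
qed

text \<open>Start from two cycles that miss one point each, and insert a 3-cycle
  \<open>t = (a p q)\<close> and its inverse \<open>t'\<close> between them, chosen to destroy both
  fixed points without creating new ones.\<close>

lemma fixed_point_free_factors:
  assumes "finite V" "card V \<ge> 6" "even (card V)" "g \<in> alt V"
  shows "\<exists>x\<in>alt V. \<exists>y\<in>alt V. g = x \<circ> y \<and> (\<forall>v\<in>V. x v \<noteq> v) \<and> (\<forall>v\<in>V. y v \<noteq> v)"
proof -
  obtain a b x y where ab: "a \<in> V" "b \<in> V" and fx: "full_cycle_on (V - {a}) x"
    and fy: "full_cycle_on (V - {b}) y" and gxy: "g = x \<circ> y"
    using even_eq_near_full_cycles[of V g] assms by auto
  have "card (V - {c}) \<ge> 2" if "c \<in> V" for c using that assms by simp
  then have card2: "card (V - {a}) \<ge> 2" "card (V - {b}) \<ge> 2" using ab by auto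
  have nx: "x v \<noteq> v" if "v \<in> V" "v \<noteq> a" for v
    using that full_cycle_on_neq[OF fx _ card2(1)] by auto
  have ny: "y v \<noteq> v" if "v \<in> V" "v \<noteq> b" for v
    using that full_cycle_on_neq[OF fy _ card2(2)] by auto
  have x: "x permutes V" and y: "y permutes V"
    using fx fy by (auto simp: full_cycle_on_def intro: permutes_subset)
  have xa: "x a = a" and yb: "y b = b"
    using fx fy by (auto simp: full_cycle_on_def permutes_not_in)
  have xi: "x u = x v \<longleftrightarrow> u = v" and yi: "y u = y v \<longleftrightarrow> u = v" for u v
    using permutes_inj[OF x] permutes_inj[OF y] by (simp_all add: inj_eq)
  have sxy: "sign x = 1" "sign y = 1" using fx fy assms ab by (auto simp: full_cycle_on_def)
  have in_V: "inv' x v \<in> V" "inv' y v \<in> V" "y v \<in> V" if "v \<in> V" for v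
    using that permutes_in_image x y permutes_inv by metis+
  have ix: "x (inv' x v) = v" and iy: "y (inv' y v) = v" for v
    using x y by (simp_all add: permutes_inverses)
  \<comment> \<open>The inequalities rule out \<open>x (t v) = v\<close> and
    \<open>y v = t v\<close> for \<open>v\<close> in \<open>{a, p, q}\<close>. Outside this set
    \<open>t\<close> is the identity and \<open>x\<close>, \<open>y\<close> fix at most
    \<open>a\<close> and \<open>b\<close>; therefore \<open>b\<close> must lie in it, which is the
    clause \<open>p = b\<close>.\<close>
  obtain p q where pq: "p \<in> V" "q \<in> V" "p \<noteq> a" "q \<noteq> a" "q \<noteq> p" "x q \<noteq> p" "y p \<noteq> q" "y q \<noteq> a"
    "a \<noteq> b \<longrightarrow> p = b" "y a \<noteq> p"
  proof (cases "a = b")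
    case True
    obtain p where p: "p \<in> V" "p \<notin> {a}"
      by (rule exists_not_in[of "{a}" V]) (use assms in auto)
    obtain q where q: "q \<in> V" "q \<notin> {a, p, inv' x p, y p}"
      by (rule exists_not_in[of "{a, p, inv' x p, y p}" V])
        (use assms card_length[of "[a, p, inv' x p, y p]"] in auto)
    have "x q \<noteq> p" using q x by (auto simp: permutes_inverses)
    moreover have "y q \<noteq> a" using q yi[of q b] yb True by auto
    ultimately show ?thesis using that[of p q] p q True yb by auto
  next
    case False
    obtain q where q: "q \<in> V" "q \<notin> {a, b, inv' x b, inv' y a}"
      by (rule exists_not_in[of "{a, b, inv' x b, inv' y a}" V])
        (use assms card_length[of "[a, b, inv' x b, inv' y a]"] in auto)
    have "x q \<noteq> b" using q x by (auto simp: permutes_inverses)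
    moreover have "y q \<noteq> a" using q y by (auto simp: permutes_inverses)
    moreover have "y a \<noteq> b" using yi[of a b] yb False by auto
    ultimately show ?thesis using that[of b q] q False yb ab by auto
  qed
  define t t' where "t = transpose a p \<circ> transpose p q" and "t' = transpose p q \<circ> transpose a p"
  have t: "t permutes V" "t' permutes V" unfolding t_def t'_def
    using ab pq by (auto intro!: permutes_compose permutes_swap_id)
  have st: "sign t = 1" "sign t' = 1" unfolding t_def t'_def
    using pq by (auto simp: sign_compose permutation_swap_id sign_swap_id)
  have perm: "permutation x" "permutation y" "permutation t" "permutation t'"
    using x y t assms permutation_if_permutes by blast+
  have tv: "t a = p" "t p = q" "t q = a" "v \<notin> {a, p, q} \<Longrightarrow> t v = v" for v
    using pq by (auto simp: t_def transpose_def)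
  have t'v: "t' (t v) = v" "t (t' v) = v" for v by (simp_all add: t_def t'_def)
  have "x \<circ> t \<in> alt V" "t' \<circ> y \<in> alt V"
    using x y t st sxy perm by (auto simp: alt_def permutes_compose sign_compose)
  moreover have "g = (x \<circ> t) \<circ> (t' \<circ> y)" using gxy t'v by (auto simp: fun_eq_iff)
  moreover have "(x \<circ> t) v \<noteq> v" if v: "v \<in> V" for v
  proof -
    consider "v = a" | "v = p" | "v = q" | "v \<notin> {a, p, q}" by blast
    then show ?thesis
    proof cases
      case 1 then show ?thesis using tv xa xi pq by (metis comp_apply)
    next
      case 2 then show ?thesis using tv pq by auto
    next
      case 3 then show ?thesis using tv xa pq by auto
    next
      case 4 then show ?thesis using tv nx v by auto
    qed
  qed
  moreover have "(t' \<circ> y) v \<noteq> v" if v: "v \<in> V" for v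
  proof -
    have "y v \<noteq> t v"
    proof -
      consider "v = a" | "v = p" | "v = q" | "v \<notin> {a, p, q}" by blast
      then show ?thesis
      proof cases
        case 4 then show ?thesis using tv ny v pq ab by (metis insert_iff)
      qed (use tv pq in auto)
    qed
    then show ?thesis using t'v by (metis comp_apply)
  qed
  ultimately show ?thesis by blast
qed

section \<open>Products of two elements whose fourth power is a 3-cycle\<close>

text \<open>The product to which \<open>cycle_of_list [a, b, c]\<close> unfolds, sending
  \<open>a\<close> to \<open>b\<close> to \<open>c\<close> to \<open>a\<close> for distinct points;
  this ties it to the library set \<open>three_cycles\<close>.\<close>

definition three_cycle :: "'a \<Rightarrow> 'a \<Rightarrow> 'a \<Rightarrow> 'a \<Rightarrow> 'a"
  where "three_cycle a b c = transpose a b \<circ> transpose b c"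

lemma three_cycle_apply:
  assumes "a \<noteq> b" "a \<noteq> c" "b \<noteq> c"
  shows "three_cycle a b c a = b" "three_cycle a b c b = c" "three_cycle a b c c = a"
    "v \<noteq> a \<Longrightarrow> v \<noteq> b \<Longrightarrow> v \<noteq> c \<Longrightarrow> three_cycle a b c v = v"
  using assms by (simp_all add: three_cycle_def transpose_def)

lemma three_cycle_in_alt:
  assumes "a \<noteq> b" "b \<noteq> c" "{a, b, c} \<subseteq> V"
  shows "three_cycle a b c \<in> alt V"
  using assms by (auto simp: three_cycle_def alt_def sign_compose permutation_swap_id sign_swap_id
      intro!: permutes_compose permutes_swap_id)

definition good :: "('a \<Rightarrow> 'a) \<Rightarrow> bool"
  where "good x \<longleftrightarrow> (\<exists>a b c. a \<noteq> b \<and> a \<noteq> c \<and> b \<noteq> c \<and> x ^^ 4 = three_cycle a b c)"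

lemma funpow_compose_commute:
  assumes "x \<circ> y = y \<circ> x"
  shows "(x \<circ> y) ^^ n = (x ^^ n) \<circ> (y ^^ n)"
proof (induction n)
  case (Suc n)
  have "y \<circ> x ^^ n = x ^^ n \<circ> y" using assms
  proof (induction n)
    case (Suc n)
    then show ?case by (metis comp_assoc funpow.simps(2))
  qed simp
  then show ?case using Suc by (simp add: fun_eq_iff)
qed simp

lemma good_compose:
  assumes "good x" "x permutes A" "z permutes B" "A \<inter> B = {}" "z ^^ 4 = id"
  shows "good (x \<circ> z)"
  using assms funpow_compose_commute[OF disjoint_permutes_commute[OF assms(2-4)], of 4]
  by (simp add: good_def)

lemma three_cycle_pow4:
  assumes "a \<noteq> b" "a \<noteq> c" "b \<noteq> c"
  shows "three_cycle a b c ^^ 4 = three_cycle a b c"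
proof
  fix v
  show "(three_cycle a b c ^^ 4) v = three_cycle a b c v"
    using assms by (cases "v = a \<or> v = b \<or> v = c") (auto simp: numeral_eq_Suc three_cycle_apply)
qed

lemma good_three_cycle:
  assumes "a \<noteq> b" "a \<noteq> c" "b \<noteq> c"
  shows "good (three_cycle a b c)"
  using assms three_cycle_pow4[of a b c] unfolding good_def by (intro exI[of _ a] exI[of _ b] exI[of _ c]) simp

lemma transpose_pow4: "transpose a b ^^ 4 = id"
  by (auto simp: numeral_eq_Suc fun_eq_iff)

section \<open>Factorisations assembled over disjoint supports\<close>

definition good_product :: "'a set \<Rightarrow> ('a \<Rightarrow> 'a) \<Rightarrow> bool"
  where "good_product V g \<longleftrightarrow> (\<exists>x\<in>alt V. \<exists>y\<in>alt V. good x \<and> good y \<and> g = x \<circ> y)"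

text \<open>The kind of factorisation required of the part of a permutation that lies off the
  3-cycles: both factors disappear in the fourth power.\<close>

definition two_product :: "'a set \<Rightarrow> ('a \<Rightarrow> 'a) \<Rightarrow> bool"
  where "two_product V h \<longleftrightarrow> (\<exists>x\<in>alt V. \<exists>y\<in>alt V. x ^^ 4 = id \<and> y ^^ 4 = id \<and> h = x \<circ> y)"

text \<open>In \<open>(s t)(x y)\<close> the middle factors have disjoint supports, so the product
  is \<open>(s x)(t y)\<close>, where \<open>x\<close> and \<open>y\<close> leave the fourth powers
  of \<open>s\<close> and \<open>t\<close> unchanged.\<close>

lemma good_product_compose:
  assumes "good_product W q" "two_product A h" "W \<inter> A = {}" "W \<union> A \<subseteq> V" "finite V"
  shows "good_product V (q \<circ> h)"
proof -
  from assms obtain s t x y where st: "s \<in> alt W" "t \<in> alt W" "good s" "good t" "q = s \<circ> t"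
    and xy: "x \<in> alt A" "y \<in> alt A" "x ^^ 4 = id" "y ^^ 4 = id" "h = x \<circ> y"
    unfolding good_product_def two_product_def by blast
  have "t \<circ> x = x \<circ> t"
    using st xy assms(3) by (intro disjoint_permutes_commute) (auto simp: alt_def)
  then have "q \<circ> h = (s \<circ> x) \<circ> (t \<circ> y)" unfolding st xy by (metis comp_assoc)
  moreover have "good (s \<circ> x)" "good (t \<circ> y)"
    using good_compose st xy assms(3) unfolding alt_def by blast+
  moreover have "s \<circ> x \<in> alt V" "t \<circ> y \<in> alt V"
    using st xy alt_mono[of W V] alt_mono[of A V] assms by (auto intro!: alt_compose)
  ultimately show ?thesis unfolding good_product_def by blast
qed

text \<open>The freedom to prescribe a fixed point \<open>p\<close> of \<open>x\<close> makes the induction work: if \<open>g\<close> maps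
  \<open>b\<close>, \<open>q\<close>, \<open>r\<close> one to the next, then \<open>b\<close> and \<open>q\<close> are stripped and \<open>x\<close> has to fix \<open>r\<close>.\<close>

lemma eq_involutions:
  assumes "finite A" "g permutes A"
  shows "\<exists>x y. x permutes A \<and> y permutes A \<and> x \<circ> x = id \<and> y \<circ> y = id \<and> g = x \<circ> y \<and> x p = p"
  using assms
proof (induction "card A" arbitrary: A g p rule: less_induct)
  case less
  have g: "g permutes A" by fact
  have gi: "g u = g v \<longleftrightarrow> u = v" for u v using permutes_inj[OF g] by (simp add: inj_eq)
  show ?case
  proof (cases "A = {}")
    case True
    then show ?thesis using g by (intro exI[of _ id]) auto
  next
    case False
    \<comment> \<open>Take \<open>q = p\<close> if \<open>p\<close> lies in \<open>A\<close>;
      otherwise \<open>x p = p\<close> holds for any \<open>x\<close> that permutes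
      \<open>A\<close>.\<close>
    then obtain q where q: "q \<in> A" "p \<in> A \<Longrightarrow> p = q" by blast
    have smaller: "card (A - B) < card A" if "q \<in> B" for B
      using less.prems q that by (intro psubset_card_mono) auto
    show ?thesis
    proof (cases "g q = q")
      case True
      have "g permutes (A - {q})" using g True by (intro permutes_Diff) auto
      then obtain x y where xy: "x permutes (A - {q})" "y permutes (A - {q})" "x \<circ> x = id" "y \<circ> y = id" "g = x \<circ> y"
        using less.hyps[OF smaller, of "{q}" g] less.prems by blast
      have "x p = p" using xy q by (metis DiffE insertCI permutes_not_in)
      then show ?thesis using xy by (blast intro: permutes_subset)
    next
      case False
      define b where "b = inv' g q"
      have b: "b \<in> A" "g b = q" unfolding b_def
        using q g by (auto simp: permutes_inverses permutes_in_image[OF permutes_inv])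
      have bq: "b \<noteq> q" using b False by auto
      have ih: "\<exists>x y. x permutes (A - {b, q}) \<and> y permutes (A - {b, q}) \<and> x \<circ> x = id \<and> y \<circ> y = id \<and> h = x \<circ> y \<and> x r = r"
        if "h permutes (A - {b, q})" for h r
        using less.hyps[OF smaller, of "{b, q}" h r] less.prems that by auto
      have swap: "transpose b r permutes A" if "r \<in> A" for r
        using that b(1) by (intro permutes_swap_id)
      show ?thesis
      proof (cases "g q = b")
        \<comment> \<open>The 2-cycle \<open>(b q)\<close> goes into \<open>y\<close> alone, so that
          \<open>x\<close> still fixes \<open>q\<close>.\<close>
        case True
        define h where "h = g \<circ> transpose b q"
        have "h permutes A" unfolding h_def using g swap q by (intro permutes_compose) auto
        moreover have "h b = b" "h q = q" using True b by (auto simp: h_def)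
        ultimately have "h permutes (A - {b, q})" by (intro permutes_Diff) auto
        from ih[OF this] obtain x y where xy: "x permutes (A - {b, q})" "y permutes (A - {b, q})"
          "x \<circ> x = id" "y \<circ> y = id" "h = x \<circ> y" by blast
        have "transpose b q permutes {b, q}" by (rule permutes_swap_id) auto
        then have c: "y \<circ> transpose b q = transpose b q \<circ> y"
          using xy by (intro disjoint_permutes_commute[of y "A - {b, q}" _ "{b, q}"]) auto
        have "(y \<circ> transpose b q) \<circ> (y \<circ> transpose b q) = id"
          using xy(4) by (subst (2) c) (auto simp: fun_eq_iff)
        moreover have "g = x \<circ> (y \<circ> transpose b q)"
          using xy(5) by (auto simp: h_def fun_eq_iff) (metis transpose_involutory)
        moreover have "x p = p" using xy q by (metis DiffE insertCI permutes_not_in)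
        moreover have "x permutes A" "y permutes A" using xy by (auto intro: permutes_subset)
        ultimately show ?thesis using xy(3) swap[OF q(1)] by (metis permutes_compose)
      next
        case False
        define r where "r = g q"
        have r: "r \<in> A" "r \<noteq> b" "r \<noteq> q" using q g False \<open>g q \<noteq> q\<close> by (auto simp: r_def permutes_in_image)
        define h where "h = transpose b r \<circ> g \<circ> transpose b q"
        have "h permutes A" unfolding h_def using g swap q r by (intro permutes_compose) auto
        moreover have "h b = b" "h q = q" using b r bq by (auto simp: h_def r_def)
        ultimately have "h permutes (A - {b, q})" by (intro permutes_Diff) auto
        from ih[OF this, of r] obtain x y where xy: "x permutes (A - {b, q})" "y permutes (A - {b, q})"
          "x \<circ> x = id" "y \<circ> y = id" "h = x \<circ> y" "x r = r" by blast
        have "transpose b q permutes {b, q}" by (rule permutes_swap_id) auto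
        then have c: "y \<circ> transpose b q = transpose b q \<circ> y"
          using xy by (intro disjoint_permutes_commute[of y "A - {b, q}" _ "{b, q}"]) auto
        have y2: "(y \<circ> transpose b q) \<circ> (y \<circ> transpose b q) = id"
          using xy(4) by (subst (2) c) (auto simp: fun_eq_iff)
        \<comment> \<open>As \<open>x\<close> fixes both \<open>b\<close> and \<open>r\<close>, it
          commutes with \<open>(b r)\<close>, and \<open>(b r) \<circ> x\<close> is again an
          involution; it fixes \<open>q\<close> as well.\<close>
        have "x b = b" using xy by (simp add: permutes_not_in)
        moreover have xx: "x (x v) = v" for v using xy(3) by (metis comp_apply id_apply)
        ultimately have "(transpose b r \<circ> x) \<circ> (transpose b r \<circ> x) = id"
          using xy(6) by (auto simp: fun_eq_iff transpose_def)
        moreover have "g = (transpose b r \<circ> x) \<circ> (y \<circ> transpose b q)"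
        proof -
          have "(transpose b r \<circ> x) \<circ> (y \<circ> transpose b q) = transpose b r \<circ> h \<circ> transpose b q"
            by (simp add: xy comp_assoc)
          also have "\<dots> = g" by (simp add: h_def fun_eq_iff)
          finally show ?thesis by simp
        qed
        moreover have xq: "x q = q" using xy by (simp add: permutes_not_in)
        then have "(transpose b r \<circ> x) p = p"
        proof (cases "p \<in> A")
          case True
          then show ?thesis using q r bq xq by auto
        next
          case False
          then have "x p = p" "p \<noteq> b" "p \<noteq> r" using xy b r by (auto simp: permutes_not_in)
          then show ?thesis by simp
        qed
        moreover have "x permutes A" "y permutes A" using xy by (auto intro: permutes_subset)
        ultimately show ?thesis using y2 swap q r by (metis permutes_compose)
      qed
    qed
  qed
qed

text \<open>Multiplying by a transposition \<open>(u v)\<close> whose two points are both fixed or both moved by the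
  involution \<open>x\<close> changes the sign of \<open>x\<close>, but keeps its order a divisor of 4.\<close>

lemma involution_transpose_pow4:
  assumes "x \<circ> x = id" "x u = u \<longleftrightarrow> x v = v" "u \<noteq> v"
  shows "(x \<circ> transpose u v) ^^ 4 = id" "(transpose u v \<circ> x) ^^ 4 = id"
proof -
  have xx: "x (x w) = w" for w using assms(1) by (metis comp_apply id_apply)
  have "((x \<circ> transpose u v) ^^ 4) w = w" for w
  proof -
    \<comment> \<open>The product gains the 2-cycle \<open>(u v)\<close>, or loses it, or fuses the
      2-cycles through \<open>u\<close> and \<open>v\<close> into a 4-cycle.\<close>
    consider "x u = u" "x v = v" | "x u = v" "x v = u"
      | "x u \<noteq> u" "x v \<noteq> v" "x u \<noteq> v" "x v \<noteq> u" using assms(2) xx by metis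
    then show ?thesis
    proof cases
      case 1
      then have "x w = u \<longleftrightarrow> w = u" "x w = v \<longleftrightarrow> w = v" using xx by metis+
      with 1 assms(3) xx show ?thesis
        by (cases "w = u"; cases "w = v") (auto simp: numeral_eq_Suc transpose_def)
    next
      case 2
      then have "x w = u \<longleftrightarrow> w = v" "x w = v \<longleftrightarrow> w = u" using xx by metis+
      with 2 assms(3) xx show ?thesis
        by (cases "w = u"; cases "w = v") (auto simp: numeral_eq_Suc transpose_def)
    next
      case 3
      then have ne: "x u \<noteq> x v" using xx assms(3) by metis
      consider "w = u" | "w = v" | "w = x u" | "w = x v" | "w \<notin> {u, v, x u, x v}" by blast
      then show ?thesis
      proof cases
        case 5
        then have "x w \<noteq> u" "x w \<noteq> v" using xx by auto
        with 5 show ?thesis using xx by (simp add: numeral_eq_Suc)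
      qed (use 3 3[symmetric] ne assms(3) xx in \<open>simp_all add: numeral_eq_Suc\<close>)
    qed
  qed
  then show *: "(x \<circ> transpose u v) ^^ 4 = id" by auto
  \<comment> \<open>The two products are conjugate by \<open>(u v)\<close>.\<close>
  have "((transpose u v \<circ> x) ^^ 4) w = transpose u v (((x \<circ> transpose u v) ^^ 4) (transpose u v w))" for w
    by (simp add: numeral_eq_Suc)
  then show "(transpose u v \<circ> x) ^^ 4 = id" unfolding * by auto
qed

text \<open>The two involutions have the same sign. If both are odd, \<open>(u v)(u v)\<close> is
  inserted between them; this requires \<open>u\<close> and \<open>v\<close> to agree in being fixed
  or moved, under \<open>x\<close> and under \<open>y\<close>. That gives four colours, so five
  points suffice.\<close>

lemma even_two_product_large:
  assumes "finite A" "h \<in> alt A" "card A \<ge> 5"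
  shows "two_product A h"
proof -
  from assms have h: "h permutes A" "sign h = 1" by (auto simp: alt_def)
  then obtain x y where xy: "x permutes A" "y permutes A" "x \<circ> x = id" "y \<circ> y = id" "h = x \<circ> y"
    using eq_involutions[OF assms(1)] by blast
  have perms: "permutation x" "permutation y" using xy assms permutation_if_permutes by blast+
  have pow4: "z ^^ 4 = id" if "z \<circ> z = id" for z :: "'a \<Rightarrow> 'a"
    using that by (simp add: numeral_eq_Suc fun_eq_iff)
  have sgn: "sign x = sign y" using h(2) perms unfolding xy sign_compose[OF perms]
    by (metis mult.commute mult.right_neutral mult.assoc sign_idempotent)
  show ?thesis
  proof (cases "sign x = 1")
    case True
    then have "x \<in> alt A" "y \<in> alt A" using xy sgn by (simp_all add: alt_def)
    then show ?thesis unfolding two_product_def using xy pow4 by blast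
  next
    case False
    then have sx: "sign x = - 1" by (simp add: sign_def split: if_splits)
    define colour where "colour v = (x v = v, y v = v)" for v
    have "card (colour ` A) \<le> card (UNIV :: (bool \<times> bool) set)" by (rule card_mono) auto
    also have "\<dots> = 4" by (simp add: card_UNIV_bool flip: UNIV_Times_UNIV)
    finally have "\<not> inj_on colour A" using assms(3) card_image[of colour A] by auto
    then obtain u v where uv: "u \<in> A" "v \<in> A" "u \<noteq> v" "colour u = colour v" by (auto simp: inj_on_def)
    have t: "transpose u v permutes A" using uv by (intro permutes_swap_id)
    have "x \<circ> transpose u v \<in> alt A" "transpose u v \<circ> y \<in> alt A"
      using sx sgn xy t uv perms
      by (auto simp: alt_def permutes_compose sign_compose permutation_swap_id sign_swap_id)
    moreover have "(x \<circ> transpose u v) ^^ 4 = id" "(transpose u v \<circ> y) ^^ 4 = id"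
      using involution_transpose_pow4[of x u v] involution_transpose_pow4[of y u v] xy uv
      by (auto simp: colour_def)
    moreover have "h = (x \<circ> transpose u v) \<circ> (transpose u v \<circ> y)" using xy by (auto simp: fun_eq_iff)
    ultimately show ?thesis unfolding two_product_def by blast
  qed
qed

section \<open>Explicit good factorisations of short cycle types\<close>

lemma good_three_cycle_swap:
  assumes "distinct [a, b, c, d, e]"
  shows "good (three_cycle a b c \<circ> transpose d e)"
proof (rule good_compose[of _ "{a, b, c}" _ "{d, e}"])
  show "good (three_cycle a b c)" using assms by (intro good_three_cycle) auto
  show "three_cycle a b c permutes {a, b, c}"
    using three_cycle_in_alt[of a b c "{a, b, c}"] assms by (auto simp: alt_def)
  show "transpose d e permutes {d, e}" by (intro permutes_swap_id) auto
qed (use assms in \<open>auto simp: transpose_pow4\<close>)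

lemma good_three_cycle_swaps:
  assumes "distinct [a, b, c, d, e, i, j]"
  shows "good (three_cycle a b c \<circ> (transpose d e \<circ> transpose i j))"
proof (rule good_compose[of _ "{a, b, c}" _ "{d, e, i, j}"])
  show "good (three_cycle a b c)" using assms by (intro good_three_cycle) auto
  show "three_cycle a b c permutes {a, b, c}"
    using three_cycle_in_alt[of a b c "{a, b, c}"] assms by (auto simp: alt_def)
  show "transpose d e \<circ> transpose i j permutes {d, e, i, j}"
    by (intro permutes_compose permutes_swap_id) auto
  have "transpose d e \<circ> transpose i j = transpose i j \<circ> transpose d e"
    using assms by (intro swap_id_independent) auto
  from funpow_compose_commute[OF this, of 4]
  show "(transpose d e \<circ> transpose i j) ^^ 4 = id" by (simp add: transpose_pow4)
qed (use assms in auto)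

lemma swaps_in_alt:
  assumes "distinct [d, e, i, j]" "{d, e, i, j} \<subseteq> V"
  shows "transpose d e \<circ> transpose i j \<in> alt V"
  using assms by (auto simp: alt_def sign_compose permutation_swap_id sign_swap_id
      intro!: permutes_compose permutes_swap_id)

text \<open>A 3-cycle is the square of its inverse.\<close>

lemma good_product_three_cycle:
  assumes "distinct [a, b, c]"
  shows "good_product {a, b, c} (three_cycle a b c)"
proof -
  have "three_cycle a c b \<in> alt {a, b, c}" using assms by (intro three_cycle_in_alt) auto
  moreover have "good (three_cycle a c b)" using assms by (intro good_three_cycle) auto
  moreover have "three_cycle a b c = three_cycle a c b \<circ> three_cycle a c b"
    using assms by (auto simp: fun_eq_iff three_cycle_def transpose_def)
  ultimately show ?thesis unfolding good_product_def by blast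
qed

text \<open>The triples may overlap: one common point yields 5-cycles, two yield double
  transpositions, and three the identity.\<close>

lemma good_product_three_cycles:
  assumes "distinct [a, b, c]" "distinct [d, e, i]"
  shows "good_product {a, b, c, d, e, i} (three_cycle a b c \<circ> three_cycle d e i)"
proof -
  have "three_cycle a b c \<in> alt {a, b, c, d, e, i}" "three_cycle d e i \<in> alt {a, b, c, d, e, i}"
    using assms by (auto intro!: three_cycle_in_alt)
  moreover have "good (three_cycle a b c)" "good (three_cycle d e i)"
    using assms by (auto intro!: good_three_cycle)
  ultimately show ?thesis unfolding good_product_def by blast
qed

text \<open>The product is \<open>(a b c d)(e i j k)\<close>.\<close>

lemma good_product_four_four:
  assumes "distinct [a, b, c, d, e, i, j, k]"
  shows "good_product {a, b, c, d, e, i, j, k}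
    ((three_cycle c e k \<circ> (transpose b d \<circ> transpose i j)) \<circ>
     (three_cycle b k c \<circ> (transpose a d \<circ> transpose e j)))"
proof -
  let ?W = "{a, b, c, d, e, i, j, k}"
  have "three_cycle c e k \<circ> (transpose b d \<circ> transpose i j) \<in> alt ?W"
    "three_cycle b k c \<circ> (transpose a d \<circ> transpose e j) \<in> alt ?W"
    using assms by (auto intro!: alt_compose[of ?W] three_cycle_in_alt swaps_in_alt)
  moreover have "good (three_cycle c e k \<circ> (transpose b d \<circ> transpose i j))"
    "good (three_cycle b k c \<circ> (transpose a d \<circ> transpose e j))"
    using assms by (auto intro!: good_three_cycle_swaps)
  ultimately show ?thesis unfolding good_product_def by blast
qed

text \<open>The product is \<open>(a b c d)(e i)\<close> with \<open>j\<close> fixed; this seventh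
  point distinguishes the situation from \<open>four_two\<close>.\<close>

lemma good_product_four_two_one:
  assumes "distinct [a, b, c, d, e, i, j]"
  shows "good_product {a, b, c, d, e, i, j}
    ((three_cycle a b c \<circ> (transpose d j \<circ> transpose e i)) \<circ> three_cycle c j d)"
proof -
  let ?W = "{a, b, c, d, e, i, j}"
  have "three_cycle a b c \<circ> (transpose d j \<circ> transpose e i) \<in> alt ?W" "three_cycle c j d \<in> alt ?W"
    using assms by (auto intro!: alt_compose[of ?W] three_cycle_in_alt swaps_in_alt)
  moreover have "good (three_cycle a b c \<circ> (transpose d j \<circ> transpose e i))" "good (three_cycle c j d)"
    using assms by (auto intro!: good_three_cycle_swaps good_three_cycle)
  ultimately show ?thesis unfolding good_product_def by blast
qed

lemma good_product_mono: "good_product W q \<Longrightarrow> W \<subseteq> V \<Longrightarrow> good_product V q"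
  unfolding good_product_def using alt_mono by blast

text \<open>The simplifier needs both orientations of each inequality to evaluate products of transpositions.\<close>

lemma distinct_neqs: "distinct (x # xs) \<longleftrightarrow> (\<forall>y\<in>set xs. x \<noteq> y \<and> y \<noteq> x) \<and> distinct xs"
  by auto

lemma good_product_imp_alt: "good_product W q \<Longrightarrow> finite W \<Longrightarrow> q \<in> alt W"
  unfolding good_product_def by (auto intro: alt_compose)

text \<open>The remainder is \<open>h = inv' q \<circ> g\<close>, which fixes \<open>W\<close>
  pointwise.\<close>

lemma peel_off:
  assumes "finite V" "g \<in> alt V" "W \<subseteq> V" "q \<in> alt W" "\<And>w. w \<in> W \<Longrightarrow> g w = q w"
  obtains h where "h \<in> alt (V - W)" "g = q \<circ> h" "\<And>v. v \<in> V - W \<Longrightarrow> h v = g v"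
proof -
  from assms have g: "g permutes V" "sign g = 1" and q: "q permutes W" "sign q = 1"
    by (auto simp: alt_def)
  have perm: "permutation g" "permutation q"
    using g q assms finite_subset permutation_if_permutes by metis+
  define h where "h = inv' q \<circ> g"
  have qq: "q (inv' q v) = v" "inv' q (q v) = v" for v using q by (simp_all add: permutes_inverses)
  have "h permutes V" unfolding h_def
    using g permutes_subset[OF permutes_inv[OF q(1)] assms(3)] by (intro permutes_compose)
  moreover have "h w = w" if "w \<in> W" for w using assms(5)[OF that] qq by (simp add: h_def)
  ultimately have h: "h permutes (V - W)" by (rule permutes_Diff)
  have "sign h = 1" unfolding h_def
    using g q perm by (simp add: sign_compose permutation_inverse sign_inverse)
  moreover have gqh: "g = q \<circ> h" using qq by (simp add: h_def fun_eq_iff)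
  moreover have "h v = g v" if "v \<in> V - W" for v
  proof -
    have "h v \<notin> W" using that permutes_in_image[OF h] by blast
    then show ?thesis using gqh q by (simp add: permutes_not_in)
  qed
  ultimately show ?thesis using that h by (simp add: alt_def)
qed

text \<open>On at most four points \<open>h\<close> is an involution, for a longer orbit would fill
  \<open>A\<close> and make \<open>h\<close> an odd 4-cycle; then \<open>h \<circ> id\<close> is the
  factorisation. Orbits of length 3 are excluded because the elements of order dividing 4 in the
  alternating group of degree 4 form a Klein four-group.\<close>

lemma two_product_without_three_cycles:
  assumes "finite A" "h \<in> alt A" "\<And>v. v \<in> A \<Longrightarrow> h (h (h v)) = v \<Longrightarrow> h v = v"
  shows "two_product A h"
proof (cases "card A \<ge> 5")
  case True
  then show ?thesis using assms even_two_product_large by blast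
next
  case False
  from assms have h: "h permutes A" "sign h = 1" by (auto simp: alt_def)
  have hi: "h u = h v \<longleftrightarrow> u = v" for u v using permutes_inj[OF h(1)] by (simp add: inj_eq)
  have hA: "h v \<in> A" if "v \<in> A" for v using that h by (simp add: permutes_in_image)
  have "h (h v) = v" for v
  proof (rule ccontr)
    assume 2: "h (h v) \<noteq> v"
    then have 1: "h v \<noteq> v" by auto
    then have v: "v \<in> A" using h permutes_not_in by metis
    have 3: "h (h (h v)) \<noteq> v" using assms(3)[OF v] 1 by blast
    define b c d where "b = h v" and "c = h b" and "d = h c"
    have ne: "distinct [v, b, c, d]" using 1 2 3 hi unfolding b_def c_def d_def by auto
    have sub: "{v, b, c, d} \<subseteq> A" using v hA unfolding b_def c_def d_def by auto
    moreover have "card {v, b, c, d} = 4" using ne by simp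
    ultimately have A: "A = {v, b, c, d}"
      using card_seteq[OF assms(1) sub] False by auto
    have "h d \<in> A" using hA sub by auto
    then have hd: "h d = v" using ne hi unfolding A b_def c_def d_def by auto
    have "h = transpose v b \<circ> transpose b c \<circ> transpose c d"
    proof
      fix w
      show "h w = (transpose v b \<circ> transpose b c \<circ> transpose c d) w"
      proof (cases "w \<in> A")
        case True
        then show ?thesis unfolding A using ne hd
          by (auto simp: transpose_def b_def[symmetric] c_def[symmetric] d_def[symmetric])
      next
        case False
        moreover have "h w = w" using False h by (simp add: permutes_not_in)
        ultimately show ?thesis unfolding A by auto
      qed
    qed
    then have "sign h = - 1" using ne
      by (simp add: sign_compose permutation_compose permutation_swap_id sign_swap_id)
    then show False using h by simp
  qed
  then have "h ^^ 4 = id" by (simp add: numeral_eq_Suc fun_eq_iff)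
  moreover have "id \<in> alt A" by (simp add: alt_def)
  moreover have "(id :: 'a \<Rightarrow> 'a) ^^ 4 = id" by simp
  ultimately show ?thesis unfolding two_product_def using assms(2) by (metis comp_id)
qed

lemma permutes_card_le_one:
  assumes "finite S" "card S \<le> 1" "p permutes S"
  shows "p = id"
proof (cases "S = {}")
  case False
  then have "card S = 1" using assms by (simp add: le_Suc_eq)
  then show ?thesis using assms(3) by (auto simp: card_1_singleton_iff)
qed (use assms in simp)

lemma peel_off_three_orbit:
  assumes "finite V" "g \<in> alt V" "g (g (g v)) = v" "g v \<noteq> v"
  obtains a b c h where "distinct [a, b, c]" "{a, b, c} \<subseteq> V" "h \<in> alt (V - {a, b, c})"
    "g = three_cycle a b c \<circ> h"
proof -
  have g: "g permutes V" using assms by (simp add: alt_def)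
  define b c where "b = g v" and "c = g b"
  have d: "distinct [v, b, c]" unfolding b_def c_def
    using assms permutes_inj[OF g] by (auto simp: inj_eq)
  have "v \<in> V" using assms(4) g permutes_not_in by metis
  then have sub: "{v, b, c} \<subseteq> V" unfolding b_def c_def using g by (simp add: permutes_in_image)
  have alt: "three_cycle v b c \<in> alt {v, b, c}" using d by (intro three_cycle_in_alt) auto
  have "g w = three_cycle v b c w" if "w \<in> {v, b, c}" for w
  proof -
    have "g v = b" "g b = c" "g c = v" using assms(3) by (simp_all add: b_def c_def)
    then show ?thesis using that d by (auto simp: three_cycle_apply)
  qed
  from peel_off[OF assms(1,2) sub alt this] obtain h where "h \<in> alt (V - {v, b, c})" "g = three_cycle v b c \<circ> h"
    by blast
  then show ?thesis using that d sub by blast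
qed

text \<open>After one 3-cycle is split off, the rest is a \<open>two_product\<close> unless it has
  fewer than five points and a further 3-cycle. In that case \<open>g\<close> is a product of two
  disjoint 3-cycles, which are themselves good.\<close>

lemma good_product_three_orbit:
  assumes "finite V" "g \<in> alt V" "g (g (g v)) = v" "g v \<noteq> v"
  shows "good_product V g"
proof -
  obtain a b c h where abc: "distinct [a, b, c]" "{a, b, c} \<subseteq> V" and h: "h \<in> alt (V - {a, b, c})"
    and g: "g = three_cycle a b c \<circ> h"
    using peel_off_three_orbit[OF assms] by blast
  have fin: "finite (V - {a, b, c})" using assms(1) by simp
  show ?thesis
  proof (cases "card (V - {a, b, c}) \<ge> 5 \<or> (\<forall>u\<in>V - {a, b, c}. h (h (h u)) = u \<longrightarrow> h u = u)")
    case True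
    then have "two_product (V - {a, b, c}) h"
      using two_product_without_three_cycles[OF fin h] even_two_product_large[OF fin h] by blast
    then show ?thesis
      using good_product_compose[OF good_product_three_cycle[OF abc(1)], of "V - {a, b, c}" h V] abc(2) assms(1)
      unfolding g by auto
  next
    case False
    then obtain u where u: "h (h (h u)) = u" "h u \<noteq> u" and c: "card (V - {a, b, c}) < 5" by auto
    obtain d e i k where dei: "distinct [d, e, i]" "{d, e, i} \<subseteq> V - {a, b, c}"
      "k \<in> alt (V - {a, b, c} - {d, e, i})" "h = three_cycle d e i \<circ> k"
      using peel_off_three_orbit[OF fin h u] by blast
    have "card {d, e, i} = 3" using dei(1) by simp
    then have "card (V - {a, b, c} - {d, e, i}) \<le> 1"
      using c card_Diff_subset[OF _ dei(2)] by simp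
    then have "k = id"
      using permutes_card_le_one[of "V - {a, b, c} - {d, e, i}" k] dei(3) fin by (simp add: alt_def)
    then have "g = three_cycle a b c \<circ> three_cycle d e i" using g dei(4) by simp
    then show ?thesis
      using good_product_mono[OF good_product_three_cycles[OF abc(1) dei(1)], of V] abc(2) dei(2) by auto
  qed
qed

text \<open>The 6-cycle \<open>(a b c d e p)\<close> has two factorisations \<open>X Y\<close> into good elements with \<open>Y p = p\<close>, namely
  \<open>(a e p)(c d) \<cdot> (a b d)\<close> and \<open>(a c p) \<cdot> (c d e)(a b)\<close>, with opposite signs of \<open>X\<close>. The rest of \<open>g\<close>,
  including the remainder of the orbit attached at \<open>p\<close>, is a product of involutions \<open>x y\<close> with
  \<open>x p = p\<close>, and the factorisation is chosen to make \<open>X x\<close> even.\<close>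

lemma good_product_long_orbit:
  assumes "finite V" "g \<in> alt V" "distinct [v, g v, g (g v), g (g (g v)), g (g (g (g v))), g (g (g (g (g v))))]"
  shows "good_product V g"
proof -
  define a b c d e p where abc: "a = v" "b = g a" "c = g b" "d = g c" "e = g d" "p = g e"
  have dist: "distinct [a, b, c, d, e, p]" using assms(3) by (simp add: abc)
  from assms have g: "g permutes V" "sign g = 1" by (auto simp: alt_def)
  have gV: "g u \<in> V \<longleftrightarrow> u \<in> V" for u using g by (simp add: permutes_in_image)
  have "a \<in> V" using dist g abc permutes_not_in by (metis distinct_length_2_or_more)
  then have sub: "{a, b, c, d, e, p} \<subseteq> V" using abc gV by auto
  define X1 Y1 where "X1 = three_cycle a e p \<circ> transpose c d" and "Y1 = three_cycle a b d"
  define X2 Y2 where "X2 = three_cycle a c p" and "Y2 = three_cycle c d e \<circ> transpose a b"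
  define W where "W = {a, b, c, d, e}"
  have gd: "good X1" "good Y1" "good X2" "good Y2"
    unfolding X1_def Y1_def X2_def Y2_def using dist
    by (auto intro!: good_three_cycle_swap good_three_cycle)
  have pX: "X1 permutes {a, b, c, d, e, p}" "X2 permutes {a, b, c, d, e, p}"
    unfolding X1_def X2_def three_cycle_def by (intro permutes_compose permutes_swap_id; simp)+
  have pY: "Y1 permutes W" "Y2 permutes W"
    unfolding Y1_def Y2_def three_cycle_def W_def by (intro permutes_compose permutes_swap_id; simp)+
  have sgn: "sign X1 = - 1" "sign Y1 = 1" "sign X2 = 1" "sign Y2 = - 1"
    unfolding X1_def Y1_def X2_def Y2_def three_cycle_def using dist
    by (auto simp: sign_compose permutation_compose permutation_swap_id sign_swap_id)
  have eq: "X1 \<circ> Y1 = X2 \<circ> Y2"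
  proof
    fix u
    show "(X1 \<circ> Y1) u = (X2 \<circ> Y2) u"
    proof (cases "u \<in> {a, b, c, d, e, p}")
      case True
      then show ?thesis unfolding X1_def Y1_def X2_def Y2_def three_cycle_def
        by (elim insertE emptyE)
            (use dist in \<open>simp_all add: transpose_def distinct_neqs del: distinct.simps(2)\<close>)
    qed (auto simp: X1_def Y1_def X2_def Y2_def three_cycle_def)
  qed
  \<comment> \<open>Not claimed at \<open>p\<close>: the 6-cycle returns \<open>p\<close> to
    \<open>a\<close>, whereas \<open>g p\<close> may be a new point. The difference is absorbed by
    \<open>h\<close>, whose support may include \<open>p\<close>.\<close>
  have val: "g w = X1 (Y1 w)" if "w \<in> W" for w
    using that unfolding W_def X1_def Y1_def three_cycle_def
    by (elim insertE emptyE)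
      (use dist in \<open>simp_all add: transpose_def distinct_neqs abc(2-6)[symmetric] del: distinct.simps(2)\<close>)
  define h where "h = inv' Y1 \<circ> (inv' X1 \<circ> g)"
  have inv1: "X1 (inv' X1 u) = u" "inv' X1 (X1 u) = u" "Y1 (inv' Y1 u) = u" "inv' Y1 (Y1 u) = u" for u
    using pX pY by (simp_all add: permutes_inverses)
  have WV: "W \<subseteq> V" and pV: "p \<in> V" "p \<notin> W" using sub dist by (auto simp: W_def)
  have "h permutes V" unfolding h_def
    using g permutes_subset[OF permutes_inv[OF pX(1)] sub] permutes_subset[OF permutes_inv[OF pY(1)] WV]
    by (intro permutes_compose)
  moreover have "h w = w" if "w \<in> W" for w using val[OF that] inv1 by (simp add: h_def)
  ultimately have h: "h permutes (V - W)" by (rule permutes_Diff)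
  obtain x y where xy: "x permutes (V - W)" "y permutes (V - W)" "x \<circ> x = id" "y \<circ> y = id" "h = x \<circ> y" "x p = p"
    using eq_involutions[OF _ h] assms(1) by blast
  have perms: "permutation x" "permutation y" "permutation X1" "permutation Y1" "permutation X2" "permutation Y2"
    "permutation g"
    using xy pX pY g assms(1) by (auto intro: permutation_if_permutes simp: W_def)
  have "sign h = - 1" unfolding h_def
    using perms sgn g by (simp add: sign_compose permutation_compose permutation_inverse sign_inverse)
  \<comment> \<open>The 6-cycle is odd, so exactly one of \<open>x\<close>, \<open>y\<close> is odd.
    The pairs \<open>(X1, Y1)\<close> and \<open>(X2, Y2)\<close> have opposite sign patterns, and
    one of them mends both factors at once.\<close>
  then have sxy: "sign x * sign y = - 1" using xy perms by (simp add: sign_compose)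
  have "x permutes (V - W - {p})" using xy by (intro permutes_Diff[OF xy(1)]) auto
  \<comment> \<open>Both pairs below are disjoint although \<open>p\<close> may be moved on either
    side: \<open>X\<close> moves \<open>p\<close> but \<open>x\<close> does not, and
    \<open>y\<close> may move \<open>p\<close> but \<open>Y\<close> does not.\<close>
  then have x': "x permutes (V - {a, b, c, d, e, p})" by (rule permutes_subset) (auto simp: W_def)
  have pow4: "x ^^ 4 = id" "y ^^ 4 = id" using xy by (simp_all add: numeral_eq_Suc fun_eq_iff)
  have result: "good_product V g"
    if XY: "X permutes {a, b, c, d, e, p}" "Y permutes W" "good X" "good Y" "X1 \<circ> Y1 = X \<circ> Y"
      "sign X * sign x = 1" "sign Y * sign y = 1" "permutation X" "permutation Y" for X Y
  proof -
    have "Y \<circ> x = x \<circ> Y" using XY(2) xy(1) by (rule disjoint_permutes_commute) auto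
    then have "(X \<circ> x) \<circ> (Y \<circ> y) = (X \<circ> Y) \<circ> h" unfolding xy by (metis comp_assoc)
    also have "\<dots> = g" unfolding XY(5)[symmetric] h_def using inv1 by (simp add: fun_eq_iff)
    finally have "g = (X \<circ> x) \<circ> (Y \<circ> y)" by simp
    moreover have "good (X \<circ> x)" using good_compose[OF XY(3,1) x' _ pow4(1)] by auto
    moreover have "good (Y \<circ> y)" using good_compose[OF XY(4,2) xy(2) _ pow4(2)] by auto
    moreover have "X \<circ> x \<in> alt V" "Y \<circ> y \<in> alt V"
      using XY perms permutes_subset[OF XY(1) sub] permutes_subset[OF XY(2) WV]
        permutes_subset[OF xy(1)] permutes_subset[OF xy(2)]
      by (auto simp: alt_def sign_compose permutes_compose)
    ultimately show ?thesis unfolding good_product_def by blast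
  qed
  show ?thesis
  proof (cases "sign x = 1")
    case True
    then show ?thesis using result[OF pX(2) pY(2) gd(3,4) eq] sgn sxy perms by simp
  next
    case False
    then have "sign x = - 1" by (simp add: sign_def split: if_splits)
    then show ?thesis using result[OF pX(1) pY(1) gd(1,2) refl] sgn sxy perms by simp
  qed
qed

text \<open>An orbit of length 3 of the remainder would be one of \<open>g\<close>; hence the
  remainder is a \<open>two_product\<close> whatever its size, and only finitely many shapes of
  \<open>q\<close> on a few orbits of \<open>g\<close> have to be supplied.\<close>

lemma good_product_peel_off:
  assumes "finite V" "g \<in> alt V" "\<And>v. g (g (g v)) = v \<Longrightarrow> g v = v"
    and "good_product W q" "W \<subseteq> V" "\<And>w. w \<in> W \<Longrightarrow> g w = q w"
  shows "good_product V g"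
proof -
  have "q \<in> alt W" using good_product_imp_alt assms(1,4,5) finite_subset by blast
  from peel_off[OF assms(1,2,5) this assms(6)] obtain h where h: "h \<in> alt (V - W)" "g = q \<circ> h"
    "\<And>v. v \<in> V - W \<Longrightarrow> h v = g v" by blast
  have "h v \<in> V - W" if "v \<in> V - W" for v
    using that h(1) permutes_in_image by (fastforce simp: alt_def)
  then have "h v = v" if "v \<in> V - W" "h (h (h v)) = v" for v
    using that assms(3)[of v] h(3) by simp
  then have "two_product (V - W) h"
    using two_product_without_three_cycles[OF _ h(1)] assms(1) by blast
  then show ?thesis
    using good_product_compose[OF assms(4), of "V - W" h V] assms(1,5) h(2) by auto
qed

definition four_two :: "'a set \<Rightarrow> ('a \<Rightarrow> 'a) \<Rightarrow> bool"
  where "four_two V g \<longleftrightarrow> (\<exists>a b c d e i. distinct [a, b, c, d, e, i] \<and> V = {a, b, c, d, e, i} \<and>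
    g a = b \<and> g b = c \<and> g c = d \<and> g d = a \<and> g e = i \<and> g i = e)"

text \<open>A counterexample has no orbit of length 3, 5 or at least 6. Two orbits of length 2, or
  two of length 4, can be peeled off, so there is at most one of each. A lone 2-cycle or 4-cycle is
  odd, the identity is a 3-cycle times its inverse, and one 2-cycle with one 4-cycle leaves a
  seventh point or is \<open>four_two\<close>.\<close>

theorem even_good_product:
  assumes "finite V" "card V \<ge> 5" "g \<in> alt V"
  shows "good_product V g \<or> four_two V g"
proof (rule ccontr)
  assume neg: "\<not> (good_product V g \<or> four_two V g)"
  from assms have g: "g permutes V" "sign g = 1" by (auto simp: alt_def)
  have gi: "g u = g v \<longleftrightarrow> u = v" for u v using permutes_inj[OF g(1)] by (simp add: inj_eq)
  have gV: "g u \<in> V \<longleftrightarrow> u \<in> V" for u using g by (simp add: permutes_in_image)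
  have moved: "u \<in> V" if "g u \<noteq> u" for u using that g permutes_not_in by metis
  have no3: "g v = v" if "g (g (g v)) = v" for v
    using good_product_three_orbit[OF assms(1,3) that] neg by blast
  note peel = good_product_peel_off[OF assms(1,3) no3]
  have no5: "g v = v" if 5: "g (g (g (g (g v)))) = v" for v
  proof (rule ccontr)
    assume 1: "g v \<noteq> v"
    define b c d e where "b = g v" and "c = g b" and "d = g c" and "e = g d"
    have gs: "g v = b" "g b = c" "g c = d" "g d = e" "g e = v" using 5 by (simp_all add: b_def c_def d_def e_def)
    have "c \<noteq> v" "d \<noteq> v" "e \<noteq> v" using gs 1 gi by metis+
    then have dist: "distinct [v, b, c, d, e]" using gs 1 gi by (simp; metis)
    have "good_product {v, b, c, c, d, e} (three_cycle v b c \<circ> three_cycle c d e)"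
      using dist by (intro good_product_three_cycles) auto
    moreover have "{v, b, c, c, d, e} \<subseteq> V" using moved[OF 1] gV gs by auto
    moreover have "g w = (three_cycle v b c \<circ> three_cycle c d e) w" if "w \<in> {v, b, c, c, d, e}" for w
      using that by (elim insertE emptyE) 
        (use dist gs in \<open>simp_all add: three_cycle_def transpose_def distinct_neqs del: distinct.simps(2)\<close>)
    ultimately show False using peel neg by blast
  qed
  have 4: "g (g (g (g v))) = v" for v
  proof (rule ccontr)
    assume 4: "g (g (g (g v))) \<noteq> v"
    then have "g v \<noteq> v" "g (g v) \<noteq> v" by metis+
    moreover have "g (g (g v)) \<noteq> v" "g (g (g (g (g v)))) \<noteq> v" using \<open>g v \<noteq> v\<close> no3 no5 by blast+
    ultimately have "distinct [v, g v, g (g v), g (g (g v)), g (g (g (g v))), g (g (g (g (g v))))]"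
      using 4 by (simp add: gi)
    then show False using good_product_long_orbit[OF assms(1,3)] neg by blast
  qed
  have two_orbit: "u \<in> {v, g v}" if u: "g (g u) = u" "g u \<noteq> u" and v: "g (g v) = v" "g v \<noteq> v" for u v
  proof (rule ccontr)
    assume uv: "u \<notin> {v, g v}"
    define b d where "b = g v" and "d = g u"
    have gs: "g v = b" "g b = v" "g u = d" "g d = u" using u v by (simp_all add: b_def d_def)
    have dist: "distinct [v, b, u, d]" using gs uv u v gi by (simp; metis)
    have "good_product {v, b, u, b, u, d} (three_cycle v b u \<circ> three_cycle b u d)"
      using dist by (intro good_product_three_cycles) auto
    moreover have "{v, b, u, b, u, d} \<subseteq> V" using moved[OF u(2)] moved[OF v(2)] gV gs by auto
    moreover have "g w = (three_cycle v b u \<circ> three_cycle b u d) w" if "w \<in> {v, b, u, b, u, d}" for w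
      using that by (elim insertE emptyE) 
        (use dist gs in \<open>simp_all add: three_cycle_def transpose_def distinct_neqs del: distinct.simps(2)\<close>)
    ultimately show False using peel neg by blast
  qed
  have four_orbit: "u \<in> {v, g v, g (g v), g (g (g v))}" if u: "g (g u) \<noteq> u" and v: "g (g v) \<noteq> v" for u v
  proof (rule ccontr)
    assume uv: "u \<notin> {v, g v, g (g v), g (g (g v))}"
    define b c d where "b = g v" and "c = g b" and "d = g c"
    define b' c' d' where "b' = g u" and "c' = g b'" and "d' = g c'"
    have gs: "g v = b" "g b = c" "g c = d" "g d = v" "g u = b'" "g b' = c'" "g c' = d'" "g d' = u"
      using 4 by (simp_all add: b_def c_def d_def b'_def c'_def d'_def)
    have "distinct [v, b, c, d]" "distinct [u, b', c', d']" using u v gs gi by (simp; metis)+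
    moreover have "u \<notin> {v, b, c, d}" using uv by (simp add: b_def c_def d_def)
    ultimately have dist: "distinct [v, b, c, d, u, b', c', d']" using gs gi by (simp; metis)
    let ?q = "(three_cycle c u d' \<circ> (transpose b d \<circ> transpose b' c')) \<circ>
        (three_cycle b d' c \<circ> (transpose v d \<circ> transpose u c'))"
    have "good_product {v, b, c, d, u, b', c', d'} ?q" using good_product_four_four[OF dist] .
    moreover have "v \<in> V" "u \<in> V" using moved u v by metis+
    then have "{v, b, c, d, u, b', c', d'} \<subseteq> V" using gV gs by auto
    moreover have "g w = ?q w" if "w \<in> {v, b, c, d, u, b', c', d'}" for w
      using that by (elim insertE emptyE)
        (use dist gs in \<open>simp_all add: three_cycle_def transpose_def distinct_neqs del: distinct.simps(2)\<close>)
    ultimately show False using peel neg by blast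
  qed
  consider (id) "\<forall>v. g v = v"
    | (two) v where "g (g v) = v" "g v \<noteq> v" "\<forall>u. g (g u) = u"
    | (four) v where "g (g v) \<noteq> v" "\<forall>u. g (g u) = u \<longrightarrow> g u = u"
    | (both) v w where "g (g v) \<noteq> v" "g (g w) = w" "g w \<noteq> w" by metis
  then show False
  proof cases
    case id
    obtain a where a: "a \<in> V" using assms by fastforce
    obtain b where b: "b \<in> V" "b \<notin> {a}" by (rule exists_not_in[of "{a}" V]) (use assms in auto)
    obtain c where c: "c \<in> V" "c \<notin> {a, b}"
      by (rule exists_not_in[of "{a, b}" V]) (use assms card_length[of "[a, b]"] in auto)
    have "good_product V (three_cycle a b c \<circ> three_cycle c b a)"
      using good_product_mono[OF good_product_three_cycles[of a b c c b a], of V] a b c by auto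
    moreover have "g = three_cycle a b c \<circ> three_cycle c b a"
      using id by (auto simp: fun_eq_iff three_cycle_def transpose_commute[of b])
    ultimately show False using neg by simp
  next
    case (two v)
    have "g = transpose v (g v)"
    proof
      fix u
      show "g u = transpose v (g v) u"
        using two two_orbit[of u v] by (cases "u \<in> {v, g v}") auto
    qed
    then have "sign g = sign (transpose v (g v))" by (rule arg_cong)
    then show False using g two by (simp add: sign_swap_id)
  next
    case (four v)
    define b c d where "b = g v" and "c = g b" and "d = g c"
    have gs: "g v = b" "g b = c" "g c = d" "g d = v" using 4 by (simp_all add: b_def c_def d_def)
    have dist: "distinct [v, b, c, d]" using four gs gi by (simp; metis)
    have "g = transpose v b \<circ> transpose b c \<circ> transpose c d"
    proof
      fix u
      show "g u = (transpose v b \<circ> transpose b c \<circ> transpose c d) u"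
      proof (cases "u \<in> {v, b, c, d}")
        case True
        then show ?thesis
          by (elim insertE emptyE)
            (use dist gs in \<open>simp_all add: transpose_def distinct_neqs del: distinct.simps(2)\<close>)
      next
        case False
        then have "g u = u" using four gs four_orbit[of u v] by auto
        then show ?thesis using False by simp
      qed
    qed
    then show False using g dist
      by (simp add: sign_compose permutation_compose permutation_swap_id sign_swap_id)
  next
    case (both v w)
    define b c d i where "b = g v" and "c = g b" and "d = g c" and "i = g w"
    have gs: "g v = b" "g b = c" "g c = d" "g d = v" "g w = i" "g i = w"
      using 4 both by (simp_all add: b_def c_def d_def i_def)
    have dist: "distinct [v, b, c, d, w, i]" using both gs gi by (simp; metis)
    have "v \<in> V" "w \<in> V" using moved both by metis+
    then have sub: "{v, b, c, d, w, i} \<subseteq> V"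
      using gV[of v] gV[of b] gV[of c] gV[of w] unfolding gs by auto
    show False
    proof (cases "V \<subseteq> {v, b, c, d, w, i}")
      case True
      with sub have "V = {v, b, c, d, w, i}" by auto
      then have "four_two V g" unfolding four_two_def using dist gs
        by (intro exI[of _ v] exI[of _ b] exI[of _ c] exI[of _ d] exI[of _ w] exI[of _ i] conjI)
      then show False using neg by simp
    next
      case False
      then obtain u where u: "u \<in> V" "u \<notin> {v, b, c, d, w, i}" by blast
      have gu: "g u = u" using u(2) four_orbit[of u v] two_orbit[of u w] both gs by auto
      let ?q = "(three_cycle v b c \<circ> (transpose d u \<circ> transpose w i)) \<circ> three_cycle c u d"
      have dist': "distinct [v, b, c, d, w, i, u]" using dist u by auto
      have "good_product {v, b, c, d, w, i, u} ?q" using good_product_four_two_one[OF dist'] .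
      moreover have "{v, b, c, d, w, i, u} \<subseteq> V" using sub u by auto
      moreover have "g z = ?q z" if "z \<in> {v, b, c, d, w, i, u}" for z
        using that by (elim insertE emptyE)
          (use dist' gs gu in \<open>simp_all add: three_cycle_def transpose_def distinct_neqs del: distinct.simps(2)\<close>)
      ultimately show False using peel neg by blast
    qed
  qed
qed

section \<open>Subgroups of alternating groups\<close>

lemma conj_eq_iff: "bij p \<Longrightarrow> p \<circ> x \<circ> inv' p = y \<longleftrightarrow> p \<circ> x = y \<circ> p"
  by (auto simp: fun_eq_iff bij_is_inj bij_is_surj surj_f_inv_f) (metis bij_inv_eq_iff)

lemma three_cycle_conjugate:
  assumes "bij p"
  shows "p \<circ> three_cycle a b c \<circ> inv' p = three_cycle (p a) (p b) (p c)"
  unfolding conj_eq_iff[OF assms] using bij_is_inj[OF assms]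
  by (auto simp: three_cycle_def fun_eq_iff transpose_def inj_eq)

lemma inv_three_cycle: "inv' (three_cycle a b c) = three_cycle c b a"
  by (rule inv_equality) (auto simp: three_cycle_def transpose_commute)

lemma conjugate_pow:
  assumes "bij p"
  shows "(p \<circ> x \<circ> inv' p) ^^ n = p \<circ> (x ^^ n) \<circ> inv' p"
proof (induction n)
  case 0
  then show ?case using assms by (simp add: fun_eq_iff bij_is_surj surj_f_inv_f)
next
  case (Suc n)
  then show ?case using assms by (simp add: fun_eq_iff bij_is_inj)
qed

lemma good_conjugate:
  assumes "good x" "bij p"
  shows "good (p \<circ> x \<circ> inv' p)"
proof -
  obtain a b c where abc: "a \<noteq> b" "a \<noteq> c" "b \<noteq> c" "x ^^ 4 = three_cycle a b c"
    using assms(1) unfolding good_def by blast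
  then have "(p \<circ> x \<circ> inv' p) ^^ 4 = three_cycle (p a) (p b) (p c)"
    using conjugate_pow[OF assms(2)] three_cycle_conjugate[OF assms(2)] by metis
  moreover have "p a \<noteq> p b" "p a \<noteq> p c" "p b \<noteq> p c" using abc bij_is_inj[OF assms(2)] by (auto simp: inj_eq)
  ultimately show ?thesis unfolding good_def by blast
qed

lemma four_two_conjugate:
  assumes "four_two V x" "p permutes V"
  shows "four_two V (p \<circ> x \<circ> inv' p)"
proof -
  obtain a b c d e i where *: "distinct [a, b, c, d, e, i]" "V = {a, b, c, d, e, i}"
    "x a = b" "x b = c" "x c = d" "x d = a" "x e = i" "x i = e"
    using assms(1) unfolding four_two_def by blast
  have "distinct (map p [a, b, c, d, e, i])"
    using *(1) permutes_inj[OF assms(2)] by (simp add: inj_eq)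
  moreover have "V = {p a, p b, p c, p d, p e, p i}" using permutes_image[OF assms(2)] *(2) by auto
  moreover have val: "(p \<circ> x \<circ> inv' p) (p u) = p (x u)" for u
    using permutes_inverses(2)[OF assms(2)] by simp
  note val[of a, unfolded *(3)] val[of b, unfolded *(4)] val[of c, unfolded *(5)]
    val[of d, unfolded *(6)] val[of e, unfolded *(7)] val[of i, unfolded *(8)]
  ultimately show ?thesis unfolding four_two_def list.map
    by (intro exI[of _ "p a"] exI[of _ "p b"] exI[of _ "p c"] exI[of _ "p d"] exI[of _ "p e"] exI[of _ "p i"] conjI)
qed

text \<open>For \<open>g = (a b c d)(e i)\<close> the second factor is
  \<open>y = (a c b d)(e i)\<close>, and \<open>g = (b d c) \<circ> y\<close>. One factor is good
  and the other again of type (4,2), so the union of both classes suffices.\<close>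

lemma four_two_factors:
  assumes "finite V" "four_two V g" "g \<in> alt V"
  shows "\<exists>x\<in>alt V. \<exists>y\<in>alt V. good x \<and> four_two V y \<and> g = x \<circ> y"
proof -
  obtain a b c d e i where *: "distinct [a, b, c, d, e, i]" "V = {a, b, c, d, e, i}"
    "g a = b" "g b = c" "g c = d" "g d = a" "g e = i" "g i = e"
    using assms(2) unfolding four_two_def by blast
  have alt: "three_cycle b d c \<in> alt V" "three_cycle c d b \<in> alt V"
    using * by (auto intro!: three_cycle_in_alt)
  define y where "y = three_cycle c d b \<circ> g"
  have "y a = c" "y c = b" "y b = d" "y d = a" "y e = i" "y i = e"
    unfolding y_def three_cycle_def using * by (simp_all add: transpose_def distinct_neqs del: distinct.simps(2))
  moreover have "distinct [a, c, b, d, e, i]" "V = {a, c, b, d, e, i}" using * by auto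
  ultimately have "four_two V y" unfolding four_two_def by blast
  moreover have "y \<in> alt V" unfolding y_def using alt assms by (intro alt_compose)
  moreover have "good (three_cycle b d c)" using * by (intro good_three_cycle) auto
  moreover have "g = three_cycle b d c \<circ> y"
    by (auto simp: y_def three_cycle_def fun_eq_iff transpose_commute[of d b] transpose_commute[of c d] transpose_commute[of c b])
  ultimately show ?thesis using alt(1) by blast
qed

lemma full_cycle_on_reach:
  "full_cycle_on S x \<Longrightarrow> u \<in> S \<Longrightarrow> v \<in> S \<Longrightarrow> \<exists>k. (x ^^ k) u = v"
  by (simp add: full_cycle_on_def)

lemma full_cycle_on_invariant:
  assumes "full_cycle_on S x" "B \<subseteq> S" "B \<noteq> {}" "\<And>b. b \<in> B \<Longrightarrow> x b \<in> B"
  shows "B = S"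
proof -
  obtain b where b: "b \<in> B" using assms by blast
  have "(x ^^ k) b \<in> B" for k by (induction k) (use b assms(4) in auto)
  then have "S \<subseteq> B" using full_cycle_on_reach[OF assms(1)] assms(2) b by (metis subset_eq)
  then show ?thesis using assms(2) by blast
qed

section \<open>Blocks, transitivity and primitivity\<close>

text \<open>A system of blocks, encoded as its equivalence relation.\<close>

definition invariant_equiv :: "'a set \<Rightarrow> ('a \<Rightarrow> 'a) set \<Rightarrow> ('a \<times> 'a) set \<Rightarrow> bool"
  where "invariant_equiv V H E \<longleftrightarrow> equiv V E \<and> (\<forall>h\<in>H. \<forall>u v. (u, v) \<in> E \<longrightarrow> (h u, h v) \<in> E)"

definition primitive :: "'a set \<Rightarrow> ('a \<Rightarrow> 'a) set \<Rightarrow> bool"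
  where "primitive V H \<longleftrightarrow> (\<forall>E. invariant_equiv V H E \<longrightarrow> E \<subseteq> Id \<or> E = V \<times> V)"

text \<open>Membership of \<open>id\<close> is not postulated but derived from some
  \<open>x \<circ> inv' x\<close>; hence the exponent \<open>Suc n\<close> in \<open>pow\<close> and
  the alternative in \<open>pow_or_id\<close>.\<close>

locale alt_subgroup =
  fixes V :: "'a set" and H :: "('a \<Rightarrow> 'a) set"
  assumes fin: "finite V"
    and alt: "H \<subseteq> alt V"
    and comp: "x \<in> H \<Longrightarrow> y \<in> H \<Longrightarrow> x \<circ> y \<in> H"
    and inverse: "x \<in> H \<Longrightarrow> inv' x \<in> H"
begin

definition transitive :: bool
  where "transitive \<longleftrightarrow> (\<forall>a\<in>V. \<forall>b\<in>V. \<exists>h\<in>H. h a = b)"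

lemma permutes: "x \<in> H \<Longrightarrow> x permutes V"
  using alt by (auto simp: alt_def)

lemma bij: "x \<in> H \<Longrightarrow> bij x"
  using permutes permutes_bij by blast

lemma pow: "x \<in> H \<Longrightarrow> x ^^ Suc n \<in> H"
proof (induction n)
  case (Suc n)
  then show ?case using comp[of x "x ^^ Suc n"] by (simp only: funpow.simps(2))
qed simp

lemma in_V: "x \<in> H \<Longrightarrow> x v \<in> V \<longleftrightarrow> v \<in> V"
  using permutes permutes_in_image by metis

lemma pow_or_id: "x \<in> H \<Longrightarrow> x ^^ k = id \<or> x ^^ k \<in> H"
  using pow by (cases k) auto

lemma conjugate: "x \<in> H \<Longrightarrow> p \<in> H \<Longrightarrow> p \<circ> x \<circ> inv' p \<in> H"
  by (simp add: comp inverse)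

text \<open>\<open>H\<close> carries blocks to blocks, so by transitivity all blocks have the same
  size, and they partition \<open>V\<close>.\<close>

lemma block_card_dvd:
  assumes "transitive" "invariant_equiv V H E" "a \<in> V"
  shows "card (E `` {a}) dvd card V"
proof -
  have E: "equiv V E" using assms(2) by (simp add: invariant_equiv_def)
  have inv: "(h u, h v) \<in> E" if "h \<in> H" "(u, v) \<in> E" for h u v
    using assms(2) that unfolding invariant_equiv_def by blast
  have eq: "card (E `` {u}) = card (E `` {a})" if "u \<in> V" for u
  proof -
    obtain h where h: "h \<in> H" "h a = u" using assms(1,3) \<open>u \<in> V\<close> unfolding transitive_def by blast
    have "inv' h u = a" using h(2) permutes_inverses(2)[OF permutes[OF h(1)]] by metis
    have "E `` {u} = h ` (E `` {a})"
    proof (intro subset_antisym subsetI)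
      fix v assume "v \<in> E `` {u}"
      then have "(a, inv' h v) \<in> E" using inv[OF inverse[OF h(1)], of u v] \<open>inv' h u = a\<close> by auto
      moreover have "v = h (inv' h v)" using permutes_inverses(1)[OF permutes[OF h(1)]] by simp
      ultimately show "v \<in> h ` (E `` {a})" by blast
    next
      fix v assume "v \<in> h ` (E `` {a})"
      then show "v \<in> E `` {u}" using inv[OF h(1)] h(2) by auto
    qed
    then show ?thesis using card_image[of h] bij_is_inj[OF bij[OF h(1)]] by (metis inj_on_subset subset_UNIV)
  qed
  have "card (E `` {a}) * card (V // E) = card (\<Union> (V // E))"
  proof (rule card_partition)
    show "finite (V // E)" using fin E by (simp add: equiv_type finite_quotient)
    show "finite (\<Union> (V // E))" using fin E by (simp add: Union_quotient)
    show "card c = card (E `` {a})" if "c \<in> V // E" for c using that eq by (auto simp: quotient_def)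
    show "c \<inter> c' = {}" if "c \<in> V // E" "c' \<in> V // E" "c \<noteq> c'" for c c'
      using quotient_disj[OF E that(1,2)] that(3) by blast
  qed
  then show ?thesis using Union_quotient[OF E] by (metis dvd_triv_left)
qed

lemma transitive_if_full_cycle:
  assumes "x \<in> H" "full_cycle_on V x"
  shows "transitive"
  unfolding transitive_def
proof (intro ballI)
  fix a b assume ab: "a \<in> V" "b \<in> V"
  then obtain k where "(x ^^ k) a = b" using full_cycle_on_reach[OF assms(2)] by blast
  moreover have "x permutes V" using permutes assms by blast
  then have "x \<circ> inv' x = id" by (rule permutes_inv_o)
  then have "id \<in> H" using comp[OF assms(1) inverse[OF assms(1)]] by simp
  ultimately show "\<exists>h\<in>H. h a = b" using pow_or_id[OF assms(1), of k] by metis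
qed

lemma invariant_pow:
  assumes "invariant_equiv V H E" "x \<in> H" "(u, v) \<in> E"
  shows "((x ^^ k) u, (x ^^ k) v) \<in> E"
  using assms pow_or_id[of x k] by (fastforce simp: invariant_equiv_def)

lemma fixed_pow: "x u = u \<Longrightarrow> (x ^^ k) u = u"
  by (induction k) auto

text \<open>Moving \<open>u\<close> to \<open>a\<close> by an element of \<open>H\<close> carries
  the related pair along; the primitivity proofs thus may start at a fixed point of a known
  cycle.\<close>

lemma transitive_move:
  assumes "transitive" "invariant_equiv V H E" "(u, v) \<in> E" "u \<noteq> v" "a \<in> V"
  obtains w where "(a, w) \<in> E" "w \<noteq> a" "w \<in> V"
proof -
  have E: "E \<subseteq> V \<times> V" using assms(2) by (simp add: invariant_equiv_def equiv_type)
  then obtain h where h: "h \<in> H" "h u = a" using assms(1,3,5) unfolding transitive_def by blast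
  then have "(a, h v) \<in> E" using assms by (auto simp: invariant_equiv_def)
  moreover have "h v \<noteq> a" using h assms(4) bij_is_inj[OF bij[OF h(1)]] by (auto simp: inj_eq)
  ultimately show ?thesis using that E by blast
qed

lemma invariant_eq_all:
  assumes "equiv V E" "\<And>z. z \<in> V \<Longrightarrow> (a, z) \<in> E"
  shows "E = V \<times> V"
proof
  show "E \<subseteq> V \<times> V" using assms(1) by (simp add: equiv_type)
  show "V \<times> V \<subseteq> E"
    using assms by (auto simp: equiv_def) (meson symD transD)
qed

text \<open>The 2-transitive case: powers of \<open>x\<close> fix \<open>a\<close> and are
  transitive on the other points, so a block that contains \<open>a\<close> and one more point
  contains everything.\<close>

lemma near_full_cycle_cases:
  assumes x: "x \<in> H" "full_cycle_on (V - {a}) x" "a \<in> V" and h: "h \<in> H" "h a \<noteq> a"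
  shows "transitive" "primitive V H"
proof -
  have xa: "x a = a" using x(2) permutes_not_in[of x _ a] by (auto simp: full_cycle_on_def)
  have reach: "\<exists>k. (x ^^ k) u = v" if "u \<in> V - {a}" "v \<in> V - {a}" for u v
    using full_cycle_on_reach[OF x(2) that] .
  have "x \<circ> inv' x = id" using permutes[OF x(1)] by (rule permutes_inv_o)
  then have id: "id \<in> H" using comp[OF x(1) inverse[OF x(1)]] by simp
  have from_a: "\<exists>k\<in>H. k a = v" if "v \<in> V" for v
  proof (cases "v = a")
    case True
    then show ?thesis using id by (intro bexI[of _ id]) auto
  next
    case False
    have "h a \<in> V - {a}" using in_V h x(3) by auto
    then obtain k where k: "(x ^^ k) (h a) = v" using reach \<open>v \<in> V\<close> False by blast
    have "x ^^ k \<in> H" using pow_or_id[OF x(1), of k] id by auto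
    then have "(x ^^ k) \<circ> h \<in> H" using comp h by blast
    then show ?thesis using k by (intro bexI[of _ "(x ^^ k) \<circ> h"]) auto
  qed
  show tr: transitive unfolding transitive_def
  proof (intro ballI)
    fix u v assume "u \<in> V" "v \<in> V"
    then obtain k l where kl: "k \<in> H" "k a = u" "l \<in> H" "l a = v" using from_a by metis
    have "inv' k u = a" using kl permutes_inverses(2)[OF permutes[OF kl(1)]] by metis
    then have "(l \<circ> inv' k) u = v" using kl by simp
    then show "\<exists>h\<in>H. h u = v" using comp inverse kl by blast
  qed
  show "primitive V H" unfolding primitive_def
  proof (intro allI impI disjCI)
    fix E assume inv: "invariant_equiv V H E" and ne: "E \<noteq> V \<times> V"
    show "E \<subseteq> Id"
    proof (rule ccontr)
      assume "\<not> E \<subseteq> Id"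
      then obtain u v where uv: "(u, v) \<in> E" "u \<noteq> v" by auto
      from transitive_move[OF tr inv uv x(3)] obtain w where w: "(a, w) \<in> E" "w \<noteq> a" "w \<in> V" .
      have "(a, z) \<in> E" if "z \<in> V" for z
      proof (cases "z = a")
        case True
        then show ?thesis using inv x(3) by (auto simp: invariant_equiv_def equiv_def refl_on_def)
      next
        case False
        then obtain k where "(x ^^ k) w = z" using reach w \<open>z \<in> V\<close> by blast
        then show ?thesis using invariant_pow[OF inv x(1) w(1), of k] fixed_pow[of x a k] xa by simp
      qed
      then have "E = V \<times> V" using invariant_eq_all inv unfolding invariant_equiv_def by blast
      then show False using ne by simp
    qed
  qed
qed

lemma primitive_if_prime:
  assumes "transitive" "prime (card V)"
  shows "primitive V H"
  unfolding primitive_def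
proof (intro allI impI disjCI)
  fix E assume inv: "invariant_equiv V H E" and ne: "E \<noteq> V \<times> V"
  then have E: "equiv V E" by (simp add: invariant_equiv_def)
  show "E \<subseteq> Id"
  proof
    fix uv assume "uv \<in> E"
    then obtain u v where uv: "uv = (u, v)" "(u, v) \<in> E" by (cases uv) auto
    then have uV: "u \<in> V" "v \<in> V" using equiv_type[OF E] by auto
    have sub: "E `` {u} \<subseteq> V" using equiv_type[OF E] by auto
    have "card (E `` {u}) dvd card V" using block_card_dvd[OF assms(1) inv uV(1)] .
    then have "card (E `` {u}) = 1 \<or> card (E `` {u}) = card V" using assms(2) prime_nat_iff by blast
    moreover have "card (E `` {u}) \<noteq> card V"
    proof
      assume "card (E `` {u}) = card V"
      then have "E `` {u} = V" using card_subset_eq[OF fin sub] by blast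
      then have "E = V \<times> V" using invariant_eq_all[OF E, of u] by blast
      then show False using ne by simp
    qed
    moreover have "u \<in> E `` {u}" "v \<in> E `` {u}" using uv equiv_class_self[OF E uV(1)] by auto
    ultimately show "uv \<in> Id" using uv(1) by (metis IdI card_1_singletonE singletonD)
  qed
qed

text \<open>If the block of \<open>a\<close> meets the cycle, it contains all of the cycle, and the
  block of \<open>b\<close>, which has a second point, joins it. Otherwise it is
  \<open>{a, b}\<close>, whose size 2 does not divide the degree.\<close>

lemma primitive_if_two_fixed:
  assumes tr: "transitive" and x: "x \<in> H" "full_cycle_on (V - {a, b}) x" and ab: "a \<in> V" "b \<in> V" "a \<noteq> b"
    and odd: "odd (card V)"
  shows "primitive V H"
  unfolding primitive_def
proof (intro allI impI disjCI)
  fix E assume inv: "invariant_equiv V H E" and ne: "E \<noteq> V \<times> V"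
  then have E: "equiv V E" by (simp add: invariant_equiv_def)
  have xa: "x a = a" using x(2) permutes_not_in[of x _ a] by (auto simp: full_cycle_on_def)
  show "E \<subseteq> Id"
  proof (rule ccontr)
    assume "\<not> E \<subseteq> Id"
    then obtain u v where uv: "(u, v) \<in> E" "u \<noteq> v" by auto
    have refl: "(a, a) \<in> E" using E ab by (auto simp: equiv_def refl_on_def)
    show False
    proof (cases "\<exists>w\<in>V - {a, b}. (a, w) \<in> E")
      case True
      then obtain w where w: "w \<in> V - {a, b}" "(a, w) \<in> E" by blast
      have most: "(a, z) \<in> E" if "z \<in> V - {a, b}" for z
      proof -
        obtain k where "(x ^^ k) w = z" using full_cycle_on_reach[OF x(2) w(1) \<open>z \<in> V - {a, b}\<close>] by blast
        then show ?thesis using invariant_pow[OF inv x(1) w(2), of k] fixed_pow[of x a k] xa by simp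
      qed
      from transitive_move[OF tr inv uv ab(2)] obtain t where t: "(b, t) \<in> E" "t \<noteq> b" "t \<in> V" .
      have "(a, t) \<in> E" using most refl t by (cases "t = a") auto
      then have "(a, b) \<in> E" using t E by (meson equiv_def symD transD)
      then have "E = V \<times> V" using invariant_eq_all[OF E, of a] most refl by (metis Diff_iff insertE singletonD)
      then show False using ne by simp
    next
      case False
      from transitive_move[OF tr inv uv ab(1)] obtain t where t: "(a, t) \<in> E" "t \<noteq> a" "t \<in> V" .
      then have "E `` {a} = {a, b}" using False refl equiv_type[OF E] by blast
      then have "2 dvd card V" using block_card_dvd[OF tr inv ab(1)] ab(3) by (simp flip: numeral_2_eq_2)
      then show False using odd by simp
    qed
  qed
qed

end

lemma full_cycle_on_alt:
  assumes "full_cycle_on (V - B) x" "odd (card (V - B))"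
  shows "x \<in> alt V"
  using assms by (auto simp: full_cycle_on_def alt_def intro: permutes_subset)

context alt_subgroup
begin

section \<open>Primitive groups and 3-cycles\<close>

text \<open>Jordan's theorem. Lying in a common 3-cycle of \<open>H\<close> is an invariant
  equivalence, so by primitivity any two points do; conjugation among these 3-cycles then adjusts
  the third point. The facts \<open>rot\<close> and \<open>rev\<close> make \<open>T\<close>
  symmetric in its arguments.\<close>

lemma three_cycles_if_primitive:
  assumes prim: "primitive V H" and abc: "distinct [a, b, c]" "three_cycle a b c \<in> H"
    and ijk: "distinct [i, j, k]" "{i, j, k} \<subseteq> V"
  shows "three_cycle i j k \<in> H"
proof -
  define T where "T i j k \<longleftrightarrow> distinct [i, j, k] \<and> three_cycle i j k \<in> H" for i j k
  have rot: "T j k i" if "T i j k" for i j k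
  proof -
    have "three_cycle i j k = three_cycle j k i"
      using that unfolding T_def by (auto simp: three_cycle_def fun_eq_iff transpose_def)
    then show ?thesis using that by (auto simp: T_def)
  qed
  have rev: "T k j i" if "T i j k" for i j k
    using that inverse[of "three_cycle i j k"] by (auto simp: T_def inv_three_cycle)
  have conj: "T (h i) (h j) (h k)" if "T i j k" "h \<in> H" for h i j k
    using that conjugate[of "three_cycle i j k" h] three_cycle_conjugate[OF bij, of h i j k]
      bij_is_inj[OF bij, of h]
    by (auto simp: T_def inj_eq)
  have app: "three_cycle l m n l = m" "three_cycle l m n m = n" "three_cycle l m n n = l"
    "v \<notin> {l, m, n} \<Longrightarrow> three_cycle l m n v = v" if "T l m n" for l m n v
    using that by (auto simp: T_def three_cycle_apply)
  have TH: "three_cycle l m n \<in> H" if "T l m n" for l m n using that by (simp add: T_def)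
  have dist: "l \<noteq> m" "l \<noteq> n" "m \<noteq> n" if "T l m n" for l m n using that by (auto simp: T_def)
  have TV: "l \<in> V" "m \<in> V" if "T l m n" for l m n
    using permutes_not_in[OF permutes[OF TH[OF that]]] app[OF that] dist[OF that] by metis+
  define E where "E = {(i, j). i \<in> V \<and> j \<in> V \<and> (i = j \<or> (\<exists>k. T i j k))}"
  have link: "\<exists>n. T i l n" if ij: "T i j k" and jl: "T j l m" and "i \<noteq> l" for i j k l m
  proof -
    consider "l = k" | "m = i" | "l \<noteq> k" "m \<noteq> i" by blast
    then show ?thesis
    proof cases
      case 1 then show ?thesis using rot rev ij by blast
    next
      case 2 then show ?thesis using rev jl by blast
    next
      \<comment> \<open>Conjugation by \<open>(j l m)\<close> fixes \<open>i\<close> and moves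
        \<open>j\<close> to \<open>l\<close>.\<close>
      case 3
      have "T (three_cycle j l m i) (three_cycle j l m j) (three_cycle j l m k)"
        using conj ij TH jl by blast
      moreover have "i \<notin> {j, l, m}" using 3 that dist by blast
      ultimately show ?thesis using app[OF jl] by metis
    qed
  qed
  have "invariant_equiv V H E"
    unfolding invariant_equiv_def
  proof (intro conjI ballI allI impI equivI)
    show "E \<subseteq> V \<times> V" "refl_on V E" by (auto simp: E_def refl_on_def)
    show "sym E"
    proof (rule symI)
      fix u v assume "(u, v) \<in> E"
      moreover have "T v u k" if "T u v k" for k using rot[OF rev[OF that]] .
      ultimately show "(v, u) \<in> E" unfolding E_def by blast
    qed
    show "trans E"
    proof (rule transI)
      fix u v w assume "(u, v) \<in> E" "(v, w) \<in> E"
      then show "(u, w) \<in> E" using link[of u v _ w] unfolding E_def by blast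
    qed
    fix h u v assume "h \<in> H" "(u, v) \<in> E"
    then show "(h u, h v) \<in> E" using conj[of u v _ h] in_V[of h] unfolding E_def by blast
  qed
  moreover have Tabc: "T a b c" using abc by (simp add: T_def)
  then have "(a, b) \<in> E" "a \<noteq> b" using TV[of a b c] dist by (auto simp: E_def)
  then have "\<not> E \<subseteq> Id" by auto
  ultimately have "E = V \<times> V" using prim unfolding primitive_def by blast
  then have "(i, j) \<in> E" if "i \<in> V" "j \<in> V" for i j using that by simp
  then have pair: "\<exists>k. T i j k" if "i \<in> V" "j \<in> V" "i \<noteq> j" for i j
    using that unfolding E_def by blast
  have "T i j k"
  proof -
    obtain m where m: "T i j m" using pair ijk by auto
    have overlap: "T i j k" if "T m j k" "m \<noteq> k" "k \<noteq> i"
    proof -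
      have mjk: "T m j k" by fact
      have "T (three_cycle m j k i) (three_cycle m j k j) (three_cycle m j k m)"
        using conj m TH[OF mjk] by blast
      then have "T i k j" using app[OF mjk] dist[OF m] that by simp
      then show ?thesis using rot rev by blast
    qed
    show ?thesis
    proof (cases "m = k")
      case True
      then show ?thesis using m by simp
    next
      case False
      have "m \<in> V" using TV[OF rot[OF rot[OF m]]] by simp
      \<comment> \<open>Conjugation by \<open>(m k r)\<close> turns \<open>(i j m)\<close> into
        \<open>(i j k)\<close>, unless \<open>r\<close> is \<open>i\<close> or \<open>j\<close>;
        these two cases need other conjugations.\<close>
      then obtain r where r: "T m k r" using pair False ijk by auto
      consider "r = i" | "r = j" | "r \<noteq> i" "r \<noteq> j" by blast
      then show ?thesis
      proof cases
        case 1
        then have mki: "T m k i" using r by simp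
        then have "T m i k" using rot rev by blast
        then have "T (three_cycle m i k i) (three_cycle m i k j) (three_cycle m i k m)"
          using conj m TH by blast
        then have "T k j i" using app[OF \<open>T m i k\<close>] dist[OF m] ijk by simp
        then show ?thesis using rev by blast
      next
        case 2
        then have "T m j k" using r rot rev by blast
        then show ?thesis using overlap False ijk by auto
      next
        case 3
        have "T (three_cycle m k r i) (three_cycle m k r j) (three_cycle m k r m)"
          using conj m TH r by blast
        moreover have "i \<notin> {m, k, r}" "j \<notin> {m, k, r}" using 3 dist[OF m] ijk by auto
        ultimately show ?thesis using app[OF r] by metis
      qed
    qed
  qed
  then show ?thesis by (simp add: T_def)
qed

text \<open>Here the degree is 6. By classification such an \<open>H\<close> would be PSL(2,5) or
  the alternating group, and PSL(2,5) has no element of order 4. The proof replaces this by an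
  explicit 3-cycle for each relative position of the two elements.\<close>

lemma three_cycle_if_four_two:
  assumes tr: transitive and y: "y \<in> H" "full_cycle_on (V - {p}) y" "p \<in> V"
    and x: "x \<in> H" "four_two V x"
  shows "\<exists>u v w. distinct [u, v, w] \<and> three_cycle u v w \<in> H"
proof -
  obtain a b c d e i where *: "distinct [a, b, c, d, e, i]" "V = {a, b, c, d, e, i}"
    "x a = b" "x b = c" "x c = d" "x d = a" "x e = i" "x i = e"
    using x(2) unfolding four_two_def by blast
  have iV: "i \<in> V" unfolding *(2) by simp
  \<comment> \<open>Conjugating by \<open>h\<close> moves the fixed point of the 5-cycle to a point
    of the 2-cycle of \<open>x\<close>.\<close>
  then obtain h where h: "h \<in> H" "h p = i" using tr y(3) unfolding transitive_def by blast
  define z where "z = h \<circ> y \<circ> inv' h"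
  have zH: "z \<in> H" unfolding z_def using conjugate y h by blast
  have "h ` (V - {p}) = V - {i}"
    using permutes_image[OF permutes[OF h(1)]] h(2) bij_is_inj[OF bij[OF h(1)]] by (simp add: image_set_diff)
  then have z: "full_cycle_on (V - {i}) z"
    using full_cycle_on_conjugate[OF y(2) fin _ permutes[OF h(1)]] unfolding z_def by auto
  have zi: "z u = z v \<longleftrightarrow> u = v" for u v using bij_is_inj[OF bij[OF zH]] by (simp add: inj_eq)
  have zS: "z u \<in> V - {i}" if "u \<in> V - {i}" for u
    using z that permutes_in_image[of z "V - {i}" u] by (simp add: full_cycle_on_def)
  have z_i: "z i = i" using z permutes_not_in[of z _ i] by (auto simp: full_cycle_on_def)
  have "card V = 6" unfolding *(2) using *(1) by simp
  then have card: "card (V - {i}) = 5" using iV by simp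
  \<comment> \<open>Rules out short cycles of \<open>z\<close>: a set closed under \<open>z\<close>
    has five elements, but would be listed with fewer.\<close>
  have closed: "card B = 5" if "B \<subseteq> V - {i}" "B \<noteq> {}" "\<And>u. u \<in> B \<Longrightarrow> z u \<in> B" for B
    using full_cycle_on_invariant[OF z that] card by simp
  \<comment> \<open>Rotating the labels of the 4-cycle arranges \<open>z e = a\<close>; six orders
    remain in which \<open>z\<close> can run through \<open>b\<close>, \<open>c\<close>,
    \<open>d\<close>.\<close>
  have step: "\<exists>u v w. distinct [u, v, w] \<and> three_cycle u v w \<in> H"
    if abc: "distinct [a, b, c, d, e, i]" "V = {a, b, c, d, e, i}"
      "x a = b" "x b = c" "x c = d" "x d = a" "x e = i" "x i = e" and ze: "z e = a" for a b c d e
  proof -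
    define q r s where "q = z a" and "r = z q" and "s = z r"
    have S: "V - {i} = {a, b, c, d, e}" using abc(1,2) by auto
    have inS: "q \<in> V - {i}" "r \<in> V - {i}" "s \<in> V - {i}" "z s \<in> V - {i}" "a \<in> V - {i}" "e \<in> V - {i}"
      unfolding q_def r_def s_def using zS abc(1) S by auto
    have ne1: "q \<noteq> a" using zi[of a e] ze abc(1) unfolding q_def by auto
    have ne2: "q \<noteq> e"
    proof
      assume "q = e"
      then have "card {a, e} = 5" using inS ze q_def by (intro closed) auto
      then show False using card_length[of "[a, e]"] by simp
    qed
    have ne3: "r \<noteq> a" "r \<noteq> q" using zi[of q e] zi[of q a] ze ne1 ne2 unfolding r_def q_def by auto
    have ne4: "r \<noteq> e"
    proof
      assume "r = e"
      then have "card {a, q, e} = 5" using inS ze q_def r_def by (intro closed) auto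
      then show False using card_length[of "[a, q, e]"] by simp
    qed
    have ne5: "s \<noteq> a" "s \<noteq> q" "s \<noteq> r"
      using zi[of r e] zi[of r a] zi[of r q] ze ne1 ne2 ne3 ne4 unfolding s_def r_def q_def by auto
    have ne6: "s \<noteq> e"
    proof
      assume "s = e"
      then have "card {a, q, r, e} = 5" using inS ze q_def r_def s_def by (intro closed) auto
      then show False using card_length[of "[a, q, r, e]"] by simp
    qed
    have ne7: "z s \<noteq> a" "z s \<noteq> q" "z s \<noteq> r" "z s \<noteq> s"
      using zi[of s e] zi[of s a] zi[of s q] zi[of s r] ze ne5 ne6 unfolding s_def r_def q_def by auto
    have "q \<in> {b, c, d}" "r \<in> {b, c, d}" "s \<in> {b, c, d}"
      using inS(1-3) ne1 ne2 ne3 ne4 ne5 ne6 unfolding S by auto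
    then have perm: "{q, r, s} = {b, c, d}" using ne3 ne5 abc(1) by auto
    have "z s \<in> {a, b, c, d, e}" using inS(4) unfolding S .
    then have zs: "z s = e" using perm ne7 by auto
    have zvals: "z a = q" "z q = r" "z r = s" "z s = e" "z e = a" "z i = i"
      using zs ze z_i by (simp_all add: q_def r_def s_def)
    have word: ?thesis if "t \<in> H" "distinct [u, v, w]" "{u, v, w} \<subseteq> V"
      "\<And>k. k \<in> {a, b, c, d, e, i} \<Longrightarrow> t k = three_cycle u v w k" for t u v w
    proof -
      have "t k = three_cycle u v w k" for k
      proof (cases "k \<in> V")
        case True
        then show ?thesis using that(4)[of k] unfolding abc(2) by blast
      next
        case False
        then have "k \<noteq> u" "k \<noteq> v" "k \<noteq> w" using that(3) by auto
        then show ?thesis using permutes_not_in[OF permutes[OF that(1)] False] that(2)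
          by (simp add: three_cycle_apply)
      qed
      then have "t = three_cycle u v w" by (rule ext)
      then show ?thesis using that(1,2) by blast
    qed
    note mem = comp x(1) zH
    note eval = abc(3-8) zvals
    have "q \<noteq> r" "q \<noteq> s" "r \<noteq> s" using ne3 ne5 by auto
    with \<open>q \<in> {b, c, d}\<close> \<open>r \<in> {b, c, d}\<close> \<open>s \<in> {b, c, d}\<close>
    consider "q = b" "r = c" "s = d" | "q = b" "r = d" "s = c"
      | "q = c" "r = b" "s = d" | "q = c" "r = d" "s = b" | "q = d" "r = b" "s = c" | "q = d" "r = c" "s = b"
      by blast
    txt \<open>The words in \<open>x\<close> and \<open>z\<close> below were found by a computer search.\<close>
    then show ?thesis
    proof cases
      case 1
      show ?thesis
      proof (rule word[of "x \<circ> z \<circ> z \<circ> z \<circ> z" a i e])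
        show "x \<circ> z \<circ> z \<circ> z \<circ> z \<in> H" by (intro mem)
        show "distinct [a, i, e]" using abc(1) by auto
        show "{a, i, e} \<subseteq> V" unfolding abc(2) by auto
        fix k assume "k \<in> {a, b, c, d, e, i}"
        then show "(x \<circ> z \<circ> z \<circ> z \<circ> z) k = three_cycle a i e k"
          by (elim insertE emptyE)
            (use abc(1) eval[unfolded 1] in
              \<open>simp_all add: three_cycle_def transpose_def distinct_neqs del: distinct.simps(2)\<close>)
      qed
    next
      case 2
      show ?thesis
      proof (rule word[of "x \<circ> z \<circ> z \<circ> x \<circ> x \<circ> x \<circ> z" c e i])
        show "x \<circ> z \<circ> z \<circ> x \<circ> x \<circ> x \<circ> z \<in> H" by (intro mem)
        show "distinct [c, e, i]" using abc(1) by auto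
        show "{c, e, i} \<subseteq> V" unfolding abc(2) by auto
        fix k assume "k \<in> {a, b, c, d, e, i}"
        then show "(x \<circ> z \<circ> z \<circ> x \<circ> x \<circ> x \<circ> z) k = three_cycle c e i k"
          by (elim insertE emptyE)
            (use abc(1) eval[unfolded 2] in
              \<open>simp_all add: three_cycle_def transpose_def distinct_neqs del: distinct.simps(2)\<close>)
      qed
    next
      case 3
      show ?thesis
      proof (rule word[of "x \<circ> x \<circ> z" c d e])
        show "x \<circ> x \<circ> z \<in> H" by (intro mem)
        show "distinct [c, d, e]" using abc(1) by auto
        show "{c, d, e} \<subseteq> V" unfolding abc(2) by auto
        fix k assume "k \<in> {a, b, c, d, e, i}"
        then show "(x \<circ> x \<circ> z) k = three_cycle c d e k"
          by (elim insertE emptyE)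
            (use abc(1) eval[unfolded 3] in
              \<open>simp_all add: three_cycle_def transpose_def distinct_neqs del: distinct.simps(2)\<close>)
      qed
    next
      case 4
      show ?thesis
      proof (rule word[of "x \<circ> x \<circ> z" b e c])
        show "x \<circ> x \<circ> z \<in> H" by (intro mem)
        show "distinct [b, e, c]" using abc(1) by auto
        show "{b, e, c} \<subseteq> V" unfolding abc(2) by auto
        fix k assume "k \<in> {a, b, c, d, e, i}"
        then show "(x \<circ> x \<circ> z) k = three_cycle b e c k"
          by (elim insertE emptyE)
            (use abc(1) eval[unfolded 4] in
              \<open>simp_all add: three_cycle_def transpose_def distinct_neqs del: distinct.simps(2)\<close>)
      qed
    next
      case 5
      show ?thesis
      proof (rule word[of "x \<circ> z \<circ> z \<circ> x \<circ> x \<circ> x \<circ> z \<circ> z \<circ> z \<circ> z" a e i])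
        show "x \<circ> z \<circ> z \<circ> x \<circ> x \<circ> x \<circ> z \<circ> z \<circ> z \<circ> z \<in> H" by (intro mem)
        show "distinct [a, e, i]" using abc(1) by auto
        show "{a, e, i} \<subseteq> V" unfolding abc(2) by auto
        fix k assume "k \<in> {a, b, c, d, e, i}"
        then show "(x \<circ> z \<circ> z \<circ> x \<circ> x \<circ> x \<circ> z \<circ> z \<circ> z \<circ> z) k = three_cycle a e i k"
          by (elim insertE emptyE)
            (use abc(1) eval[unfolded 5] in
              \<open>simp_all add: three_cycle_def transpose_def distinct_neqs del: distinct.simps(2)\<close>)
      qed
    next
      case 6
      show ?thesis
      proof (rule word[of "x \<circ> z" b i e])
        show "x \<circ> z \<in> H" by (intro mem)
        show "distinct [b, i, e]" using abc(1) by auto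
        show "{b, i, e} \<subseteq> V" unfolding abc(2) by auto
        fix k assume "k \<in> {a, b, c, d, e, i}"
        then show "(x \<circ> z) k = three_cycle b i e k"
          by (elim insertE emptyE)
            (use abc(1) eval[unfolded 6] in
              \<open>simp_all add: three_cycle_def transpose_def distinct_neqs del: distinct.simps(2)\<close>)
      qed
    qed
  qed
  have eS: "e \<in> V - {i}" using * by auto
  have "z e \<noteq> e" using full_cycle_on_neq[OF z eS] card by simp
  then have "z e \<in> {a, b, c, d}" using zS[OF eS] unfolding *(2) by auto
  moreover have "distinct [b, c, d, a, e, i]" "distinct [c, d, a, b, e, i]" "distinct [d, a, b, c, e, i]"
    "V = {b, c, d, a, e, i}" "V = {c, d, a, b, e, i}" "V = {d, a, b, c, e, i}" using * by auto
  ultimately show ?thesis using step * by (elim insertE emptyE) blast+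
qed

end

section \<open>Choice of a class that avoids a proper subgroup\<close>

context alt_subgroup
begin

text \<open>In a transitive action with point stabiliser \<open>H\<close>, an element fixes some
  point only if a conjugate of it lies in \<open>H\<close>; elements of this set are therefore
  derangements.\<close>

definition avoiding :: "('a \<Rightarrow> 'a) set"
  where "avoiding = {x \<in> alt V. \<forall>p\<in>alt V. p \<circ> x \<circ> inv' p \<notin> H}"

lemma factors_if_class:
  assumes "\<And>x p. C x \<Longrightarrow> p permutes V \<Longrightarrow> C (p \<circ> x \<circ> inv' p)" "\<And>x. x \<in> H \<Longrightarrow> \<not> C x"
    and "\<exists>x\<in>alt V. \<exists>y\<in>alt V. C x \<and> C y \<and> g = x \<circ> y"
  shows "\<exists>x\<in>avoiding. \<exists>y\<in>avoiding. g = x \<circ> y"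
proof -
  have "x \<in> avoiding" if "x \<in> alt V" "C x" for x
    using that assms(1,2) unfolding avoiding_def alt_def by blast
  then show ?thesis using assms(3) by blast
qed

lemma factors_if_primitive:
  assumes prim: "primitive V H" and "card V \<ge> 5" "g \<in> alt V"
    and no3: "\<And>u v w. distinct [u, v, w] \<Longrightarrow> three_cycle u v w \<notin> H"
    and no42: "\<And>x. x \<in> H \<Longrightarrow> \<not> four_two V x"
  shows "\<exists>x\<in>avoiding. \<exists>y\<in>avoiding. g = x \<circ> y"
proof (rule factors_if_class[of "\<lambda>x. good x \<or> four_two V x"])
  fix x p assume "good x \<or> four_two V x" "p permutes V"
  then show "good (p \<circ> x \<circ> inv' p) \<or> four_two V (p \<circ> x \<circ> inv' p)"
    using good_conjugate four_two_conjugate permutes_bij by blast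
next
  fix x assume x: "x \<in> H"
  have "x ^^ 4 \<in> H" using pow[OF x, of 3] by (simp add: eval_nat_numeral)
  then have "\<not> good x" using no3 unfolding good_def by auto
  then show "\<not> (good x \<or> four_two V x)" using no42 x by blast
next
  show "\<exists>x\<in>alt V. \<exists>y\<in>alt V. (good x \<or> four_two V x) \<and> (good y \<or> four_two V y) \<and> g = x \<circ> y"
    using even_good_product[OF fin assms(2,3)] four_two_factors[OF fin _ assms(3)]
    unfolding good_product_def by blast
qed

theorem factors_avoiding:
  assumes card: "card V \<ge> 5" and g: "g \<in> alt V"
    and proper: "distinct [i, j, k]" "{i, j, k} \<subseteq> V" "three_cycle i j k \<notin> H"
  shows "\<exists>x\<in>avoiding. \<exists>y\<in>avoiding. g = x \<circ> y"
proof -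
  have no3: "three_cycle u v w \<notin> H" if "primitive V H" "distinct [u, v, w]" for u v w
    using three_cycles_if_primitive[OF that] proper by blast
  have image_Diff: "p ` (V - B) = V - p ` B" if "p permutes V" for p B
    using permutes_image[OF that] permutes_inj[OF that] by (simp add: image_set_diff)
  show ?thesis
  proof (cases "odd (card V)")
    case odd: True
    then have no42: "\<not> four_two V x" for x unfolding four_two_def by auto
    \<comment> \<open>Settles the primitive case in odd degree, so that below a proof of primitivity
      is enough.\<close>
    have five: "\<not> primitive V H" if "\<not> ?thesis"
      using factors_if_primitive[OF _ card g no3 no42] that by blast
    show ?thesis
    proof (cases "\<exists>x\<in>H. full_cycle_on V x")
      case False
      show ?thesis
      proof (rule factors_if_class[of "full_cycle_on V"])
        show "full_cycle_on V (p \<circ> x \<circ> inv' p)" if "full_cycle_on V x" "p permutes V" for x p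
          using full_cycle_on_conjugate[OF that(1) fin subset_refl that(2)] permutes_image[OF that(2)] by simp
        have "x \<in> alt V" if "full_cycle_on V x" for x
          using full_cycle_on_alt[of V "{}" x] that odd by simp
        then show "\<exists>x\<in>alt V. \<exists>y\<in>alt V. full_cycle_on V x \<and> full_cycle_on V y \<and> g = x \<circ> y"
          using even_eq_full_cycles[OF fin _ g] proper(2) by blast
      qed (use False in blast)
    next
      case True
      then have tr: transitive using transitive_if_full_cycle by blast
      show ?thesis
      proof (cases "card V \<ge> 8")
        case False
        \<comment> \<open>Both degrees are prime, so blocks are trivial. The first composite odd
          degree is 9, where \<open>even_eq_cycles_two_fixed\<close> is available.\<close>
        then have "card V = 5 \<or> card V = 7" using odd card by presburger
        then have "prime (card V)" by auto
        then show ?thesis using primitive_if_prime[OF tr] five by blast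
      next
        case large: True
        let ?C = "\<lambda>x. \<exists>a\<in>V. \<exists>b\<in>V. a \<noteq> b \<and> full_cycle_on (V - {a, b}) x"
        show ?thesis
        proof (cases "\<exists>x\<in>H. ?C x")
          case True
          then show ?thesis using primitive_if_two_fixed[OF tr _ _ _ _ _ odd] five by blast
        next
          case False
          show ?thesis
          proof (rule factors_if_class[of ?C])
            fix x p assume "?C x" and p: "p permutes V"
            then obtain a b where ab: "a \<in> V" "b \<in> V" "a \<noteq> b" "full_cycle_on (V - {a, b}) x" by blast
            have "full_cycle_on (V - {p a, p b}) (p \<circ> x \<circ> inv' p)"
              using full_cycle_on_conjugate[OF ab(4) fin _ p] image_Diff[OF p, of "{a, b}"] by simp
            moreover have "p a \<in> V" "p b \<in> V" "p a \<noteq> p b"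
              using ab p permutes_inj[OF p] by (simp_all add: permutes_in_image inj_eq)
            ultimately show "?C (p \<circ> x \<circ> inv' p)" by blast
          next
            have "x \<in> alt V" if "a \<in> V" "b \<in> V" "a \<noteq> b" "full_cycle_on (V - {a, b}) x" for x a b
              using full_cycle_on_alt[OF that(4)] that(1-3) odd card fin
              by (simp add: card_Diff_subset)
            then show "\<exists>x\<in>alt V. \<exists>y\<in>alt V. ?C x \<and> ?C y \<and> g = x \<circ> y"
              using even_eq_cycles_two_fixed[OF fin large g] by (elim bexE exE conjE) metis
          qed (use False in blast)
        qed
      qed
    qed
  next
    case False
    then have even: "even (card V)" by simp
    then have card6: "card V \<ge> 6" using card by presburger
    let ?C = "\<lambda>x. \<exists>a\<in>V. full_cycle_on (V - {a}) x"
    show ?thesis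
    proof (cases "\<exists>x\<in>H. ?C x")
      case False
      show ?thesis
      proof (rule factors_if_class[of ?C])
        fix x p assume "?C x" and p: "p permutes V"
        then obtain a where a: "a \<in> V" "full_cycle_on (V - {a}) x" by blast
        have "full_cycle_on (V - {p a}) (p \<circ> x \<circ> inv' p)"
          using full_cycle_on_conjugate[OF a(2) fin _ p] image_Diff[OF p, of "{a}"] by simp
        then show "?C (p \<circ> x \<circ> inv' p)" using a(1) p permutes_in_image by metis
      next
        have "x \<in> alt V" if "a \<in> V" "full_cycle_on (V - {a}) x" for x a
          using full_cycle_on_alt[OF that(2)] that(1) even card fin by (cases "V = {}") simp_all
        then show "\<exists>x\<in>alt V. \<exists>y\<in>alt V. ?C x \<and> ?C y \<and> g = x \<circ> y"
          using even_eq_near_full_cycles[OF fin order_trans[OF _ card] g] by (simp; blast)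
      qed (use False in blast)
    next
      case True
      then obtain y a where y: "y \<in> H" "a \<in> V" "full_cycle_on (V - {a}) y" by blast
      show ?thesis
      proof (cases "\<exists>h\<in>H. h a \<noteq> a")
        case True
        then obtain h where "h \<in> H" "h a \<noteq> a" by blast
        note tr = near_full_cycle_cases[OF y(1,3,2) this]
        \<comment> \<open>Only degree 6 is at stake: a member of \<open>H\<close> of this type would
          yield a 3-cycle in a primitive proper \<open>H\<close>.\<close>
        have "\<not> four_two V x" if "x \<in> H" for x
          using three_cycle_if_four_two[OF tr(1) y(1,3,2) that] no3[OF tr(2)] by blast
        then show ?thesis using factors_if_primitive[OF tr(2) card g no3[OF tr(2)]] by blast
      next
        case False
        show ?thesis
        proof (rule factors_if_class[of "\<lambda>x. \<forall>v\<in>V. x v \<noteq> v"])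
          fix x p assume x: "\<forall>v\<in>V. x v \<noteq> v" and p: "p permutes V"
          show "\<forall>v\<in>V. (p \<circ> x \<circ> inv' p) v \<noteq> v"
          proof
            fix v assume "v \<in> V"
            then have "inv' p v \<in> V" using permutes_in_image[OF permutes_inv[OF p]] by blast
            then have "x (inv' p v) \<noteq> inv' p v" using x by blast
            then show "(p \<circ> x \<circ> inv' p) v \<noteq> v" using permutes_inverses[OF p] by (metis comp_apply)
          qed
        next
          show "\<exists>x\<in>alt V. \<exists>y\<in>alt V. (\<forall>v\<in>V. x v \<noteq> v) \<and> (\<forall>v\<in>V. y v \<noteq> v) \<and> g = x \<circ> y"
            using fixed_point_free_factors[OF fin card6 even g] by blast
        qed (use False y(2) in blast)
      qed
    qed
  qed
qed

end

section \<open>Transfer to an arbitrary transitive action\<close>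

lemma alt_group_carrier_eq: "carrier (alt_group n) = alt {1..n}"
  by (auto simp: alt_group_carrier alt_def sign_def)

lemma three_cycles_subset:
  "three_cycles n \<subseteq> {three_cycle a b c |a b c. distinct [a, b, c] \<and> {a, b, c} \<subseteq> {1..n}}"
proof
  fix p assume "p \<in> three_cycles n"
  then obtain cs where cs: "p = cycle_of_list cs" "distinct cs" "length cs = 3" "set cs \<subseteq> {1..n}" by blast
  from cs(3) obtain a b c where "cs = [a, b, c]" by (auto simp: numeral_eq_Suc length_Suc_conv)
  with cs have "p = three_cycle a b c" "distinct [a, b, c]" "{a, b, c} \<subseteq> {1..n}"
    by (simp_all add: three_cycle_def)
  then show "p \<in> {three_cycle a b c |a b c. distinct [a, b, c] \<and> {a, b, c} \<subseteq> {1..n}}" by blast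
qed

theorem theorem11p2:
  fixes \<Omega> :: "'a set" and G :: "('a \<Rightarrow> 'a) set" and n :: nat
  assumes "finite \<Omega>"
    and "transitive_perm_group \<Omega> G"
    and "n \<ge> 5"
    and "perm_group \<Omega> G \<cong> alt_group n"
  shows "\<forall>g\<in>G. \<exists>x\<in>derangements \<Omega> G. \<exists>y\<in>derangements \<Omega> G.
           g = x \<otimes>\<^bsub>BijGroup \<Omega>\<^esub> y"
proof
  fix g assume gG: "g \<in> G"
  let ?P = "perm_group \<Omega> G" and ?V = "{1..n}"
  from assms(2) have sub: "subgroup G (BijGroup \<Omega>)" and "transitive_action ?P \<Omega> (\<lambda>g. g)"
    by (auto simp: transitive_perm_group_def)
  interpret A: transitive_action ?P \<Omega> "\<lambda>g. g" by fact
  interpret P: group ?P using sub group_BijGroup by (rule group.subgroup_imp_group[rotated])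
  obtain \<phi> where iso: "\<phi> \<in> iso ?P (alt_group n)" using assms(4) by (auto simp: is_iso_def)
  then have hom: "\<phi> \<in> hom ?P (alt_group n)" and \<phi>_bij: "bij_betw \<phi> G (alt ?V)"
    by (auto simp: iso_def alt_group_carrier_eq)
  interpret \<phi>: group_hom ?P "alt_group n" \<phi>
    using hom alt_group_is_group P.group_axioms by (simp add: group_hom_def group_hom_axioms_def)
  have mult: "\<phi> (x \<otimes>\<^bsub>?P\<^esub> y) = \<phi> x \<circ> \<phi> y" if "x \<in> G" "y \<in> G" for x y
    using \<phi>.hom_mult[of x y] that by (simp add: alt_group_mult)
  have closed: "\<phi> x \<in> alt ?V" if "x \<in> G" for x using that \<phi>_bij bij_betwE by blast
  have inv: "\<phi> (inv\<^bsub>?P\<^esub> x) = inv' (\<phi> x)" if "x \<in> G" for x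
    using \<phi>.hom_inv[of x] that closed[OF that] by (simp add: alt_group_inv_equality alt_group_carrier_eq)
  have GI: "x \<otimes>\<^bsub>?P\<^esub> y \<in> G" "inv\<^bsub>?P\<^esub> x \<in> G" if "x \<in> G" "y \<in> G" for x y
    using that P.m_closed[of x y] P.inv_closed[of x] by simp_all
  have act: "(x \<otimes>\<^bsub>?P\<^esub> y) w = x (y w)" if "x \<in> G" "y \<in> G" "w \<in> \<Omega>" for x y w
    using A.composition_rule that by simp
  have act_inv: "(inv\<^bsub>?P\<^esub> x) (x w) = w" if "x \<in> G" "w \<in> \<Omega>" for x w
    using A.orbit_sym_aux[of x w "x w"] that by simp
  have three_in: "three_cycle 1 2 3 \<in> alt ?V" using assms(3) by (intro three_cycle_in_alt) auto
  \<comment> \<open>Provides a proper stabiliser. Members of \<open>BijGroup\<close> are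
    extensional, so a group that acts trivially has one element, whereas \<open>alt\<close> contains
    \<open>id\<close> and a 3-cycle.\<close>
  have nontrivial: "\<exists>x\<in>G. \<exists>w\<in>\<Omega>. x w \<noteq> w"
  proof (rule ccontr)
    assume fixed: "\<not> ?thesis"
    have "x = (\<lambda>w\<in>\<Omega>. w)" if "x \<in> G" for x
    proof
      fix w
      have "x \<in> extensional \<Omega>" using A.bij_prop0[of x] that by (simp add: Bij_def)
      then show "x w = (\<lambda>w\<in>\<Omega>. w) w" using fixed that by (cases "w \<in> \<Omega>") (auto simp: extensional_def)
    qed
    then have "\<phi> x = \<phi> y" if "x \<in> G" "y \<in> G" for x y using that by metis
    moreover obtain x y where "x \<in> G" "\<phi> x = id" "y \<in> G" "\<phi> y = three_cycle 1 2 3"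
    proof -
      have "id \<in> \<phi> ` G" "three_cycle 1 2 3 \<in> \<phi> ` G"
        unfolding bij_betw_imp_surj_on[OF \<phi>_bij] using three_in by (simp_all add: alt_def)
      then show ?thesis using that by (metis imageE)
    qed
    ultimately have "three_cycle 1 2 3 = (id :: nat \<Rightarrow> nat)" by metis
    then have "(three_cycle 1 2 3 :: nat \<Rightarrow> nat) 1 = id 1" by (rule fun_cong)
    then show False by (simp add: three_cycle_apply)
  qed
  then obtain x0 \<omega> where x0: "x0 \<in> G" "\<omega> \<in> \<Omega>" "x0 \<omega> \<noteq> \<omega>" by blast
  define H where "H = \<phi> ` {x \<in> G. x \<omega> = \<omega>}"
  interpret alt_subgroup ?V H
  proof
    show "finite ?V" by simp
    show "H \<subseteq> alt ?V" using closed by (auto simp: H_def)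
    show "x \<circ> y \<in> H" if "x \<in> H" "y \<in> H" for x y
    proof -
      obtain u v where "u \<in> G" "u \<omega> = \<omega>" "x = \<phi> u" "v \<in> G" "v \<omega> = \<omega>" "y = \<phi> v"
        using \<open>x \<in> H\<close> \<open>y \<in> H\<close> unfolding H_def by blast
      then show ?thesis unfolding H_def
        using mult GI act x0(2) by (intro image_eqI[of _ _ "u \<otimes>\<^bsub>?P\<^esub> v"]) (simp_all del: BijGroup_def)
    qed
    show "inv' x \<in> H" if "x \<in> H" for x
    proof -
      obtain u where u: "u \<in> G" "u \<omega> = \<omega>" "x = \<phi> u" using \<open>x \<in> H\<close> unfolding H_def by blast
      then have "(inv\<^bsub>?P\<^esub> u) \<omega> = \<omega>" using act_inv[of u \<omega>] x0(2) by simp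
      then show ?thesis unfolding H_def using u inv GI by (intro image_eqI[of _ _ "inv\<^bsub>?P\<^esub> u"]) simp_all
    qed
  qed
  \<comment> \<open>The 3-cycles generate the alternating group; if all of them were in
    \<open>H\<close>, then so would be the image of \<open>x0\<close>, which moves
    \<open>\<omega>\<close>.\<close>
  have "\<exists>i j k. distinct [i, j, k] \<and> {i, j, k} \<subseteq> ?V \<and> three_cycle i j k \<notin> H"
  proof (rule ccontr)
    assume all: "\<not> ?thesis"
    have "three_cycles n \<subseteq> H"
    proof
      fix p assume "p \<in> three_cycles n"
      then obtain i j k where "p = three_cycle i j k" "distinct [i, j, k]" "{i, j, k} \<subseteq> ?V"
        using three_cycles_subset[of n] by blast
      then show "p \<in> H" using all by blast
    qed
    moreover have "subgroup H (alt_group n)"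
    proof
      show "H \<subseteq> carrier (alt_group n)" using alt by (simp add: alt_group_carrier_eq)
      have "\<phi> \<one>\<^bsub>?P\<^esub> = \<one>\<^bsub>alt_group n\<^esub>" by (rule \<phi>.hom_one)
      moreover have "\<one>\<^bsub>?P\<^esub> \<in> G" using P.one_closed by simp
      moreover have "\<one>\<^bsub>?P\<^esub> \<omega> = \<omega>" using A.id_eq_one x0(2) by (metis restrict_apply')
      ultimately show "\<one>\<^bsub>alt_group n\<^esub> \<in> H" unfolding H_def by force
      show "x \<otimes>\<^bsub>alt_group n\<^esub> y \<in> H" if "x \<in> H" "y \<in> H" for x y
        using that comp by (simp add: alt_group_mult)
      show "inv\<^bsub>alt_group n\<^esub> x \<in> H" if "x \<in> H" for x
        using that inverse alt by (simp add: alt_group_inv_equality alt_group_carrier_eq subset_iff)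
    qed
    ultimately have "carrier (alt_group n) \<subseteq> H"
      unfolding alt_group_carrier_as_three_cycles
      by (rule group.generate_subgroup_incl[OF alt_group_is_group])
    then obtain u where u: "u \<in> G" "u \<omega> = \<omega>" "\<phi> x0 = \<phi> u"
      using closed[OF x0(1)] unfolding H_def alt_group_carrier_eq by blast
    then have "x0 = u" using bij_betw_imp_inj_on[OF \<phi>_bij] x0(1) by (meson inj_onD)
    then show False using x0(3) u(2) by simp
  qed
  then obtain i j k where ijk: "distinct [i, j, k]" "{i, j, k} \<subseteq> ?V" "three_cycle i j k \<notin> H"
    by blast
  have "card ?V \<ge> 5" using assms(3) by simp
  from factors_avoiding[OF this closed[OF gG] ijk] obtain x' y' where
    xy': "x' \<in> avoiding" "y' \<in> avoiding" "\<phi> g = x' \<circ> y'" by blast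
  have der: "\<exists>x\<in>derangements \<Omega> G. \<phi> x = x'" if x': "x' \<in> avoiding" for x'
  proof -
    have "x' \<in> alt ?V" using x' unfolding avoiding_def by blast
    then obtain x where x: "x \<in> G" "\<phi> x = x'" using \<phi>_bij by (metis bij_betw_iff_bijections)
    have "x v \<noteq> v" if v: "v \<in> \<Omega>" for v
    proof
      assume xv: "x v = v"
      obtain k where k: "k \<in> G" "k \<omega> = v" using A.unique_orbit[OF x0(2) v] by auto
      \<comment> \<open>If \<open>x\<close> fixes \<open>v = k \<omega>\<close>, its conjugate by
        the inverse of \<open>k\<close> fixes \<open>\<omega>\<close>, and so the corresponding
        conjugate of \<open>x'\<close> lies in \<open>H\<close>.\<close>
      let ?k = "inv\<^bsub>?P\<^esub> k"
      have "(?k \<otimes>\<^bsub>?P\<^esub> x) \<otimes>\<^bsub>?P\<^esub> k \<in> G" using GI x k by blast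
      moreover have "((?k \<otimes>\<^bsub>?P\<^esub> x) \<otimes>\<^bsub>?P\<^esub> k) \<omega> = \<omega>"
        using act[of "?k \<otimes>\<^bsub>?P\<^esub> x" k \<omega>] act[of ?k x v] act_inv[of k \<omega>] GI x k x0(2) v xv by metis
      ultimately have "\<phi> ((?k \<otimes>\<^bsub>?P\<^esub> x) \<otimes>\<^bsub>?P\<^esub> k) \<in> H" unfolding H_def by blast
      moreover have "\<phi> ((?k \<otimes>\<^bsub>?P\<^esub> x) \<otimes>\<^bsub>?P\<^esub> k) = inv' (\<phi> k) \<circ> x' \<circ> \<phi> k"
        using mult[of "?k \<otimes>\<^bsub>?P\<^esub> x" k] mult[of ?k x] inv[OF k(1)] GI[OF k(1)] GI[of ?k x] x k by metis
      moreover have "\<phi> k permutes ?V" using closed[OF k(1)] by (simp add: alt_def)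
      then have "inv' (inv' (\<phi> k)) = \<phi> k" by (rule permutes_inv_inv)
      moreover have "inv' (\<phi> k) \<in> alt ?V" using closed[OF GI(2)[OF k(1) k(1)]] inv[OF k(1)] by simp
      ultimately show False using x' unfolding avoiding_def by force
    qed
    then show ?thesis using x by (auto simp: derangements_def)
  qed
  obtain x y where xy: "x \<in> derangements \<Omega> G" "\<phi> x = x'" "y \<in> derangements \<Omega> G" "\<phi> y = y'"
    using der xy' by metis
  then have G: "x \<in> G" "y \<in> G" by (auto simp: derangements_def)
  then have "\<phi> g = \<phi> (x \<otimes>\<^bsub>?P\<^esub> y)" using mult xy' xy by simp
  then have "g = x \<otimes>\<^bsub>?P\<^esub> y" using \<phi>_bij gG GI(1)[OF G] unfolding bij_betw_def inj_on_def by blast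
  then show "\<exists>x\<in>derangements \<Omega> G. \<exists>y\<in>derangements \<Omega> G. g = x \<otimes>\<^bsub>BijGroup \<Omega>\<^esub> y"
    using xy by auto
qed

end
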